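(* Let $\Gamma=(G,\sigma)$ be a connected signed graph containing at least one cycle, with girth $g$, and let $C_g^\sigma$ be a shortest cycle of $\Gamma$. Then $i_-(\Gamma)\ge \lceil g/2\rceil-1$. Moreover, equality holds if and only if one of the following holds: (1) $\Gamma=C_g^\sigma$ is a cycle, and either $C_g^\sigma$ is balanced with $g\equiv 0,1 \pmod 4$, or $C_g^\sigma$ is unbalanced with $g\equiv 2,3\pmod 4$; (2) $\Gamma$ is switching equivalent to $(K_{n_1,n_2},+)$ (the complete bipartite graph with all edges positive), or $\Gamma$ is a signed complete multipartite graph $K^\sigma_{n_1,n_2,\dots,n_l}$ with $l\ge 3$ parts in which every 3-cycle is unbalanced (negative).
   Context: A signed graph $\Gamma=(G,\sigma)$ is a simple graph $G$ with a sign function $\sigma:E(G)\to\{+,-\}$; $(G,+)$ denotes all edges positive. Its adjacency matrix $A(\Gamma)$ has $(u,v)$-entry $\sigma(uv)$ if $uv\in E(G)$ and $0$ otherwise; $i_+(\Gamma)$, $i_-(\Gamma)$, $\eta(\Gamma)$ are the numbers of positive, negative, zero eigenvalues of $A(\Gamma)$. The sign of a cycle is the product of the signs of its edges; a cycle is positive (balanced) if its sign is $+$ and negative (unbalanced) otherwise; a signed graph is balanced if all its cycles are positive. Switching by a function $\theta:V\to\{+,-\}$ replaces $\sigma(xy)$ by $\theta(x)\sigma(xy)\theta(y)$; two signed graphs are switching equivalent if one is obtained from the other by switching (switching preserves inertia indices and balance of cycles). The girth $g$ is the length of a shortest cycle. $K_{n_1,\dots,n_l}$ denotes the complete multipartite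 graph with parts of sizes $n_1,\dots,n_l$. *)

theory Defs
  imports "Jordan_Normal_Form.Char_Poly"
begin

text \<open>A signed graph on the vertex set {0..<n} is encoded by its signed adjacency
  function S: S u v = sigma(uv) in {1,-1} if uv is an edge, and 0 otherwise.\<close>

definition signed_graph :: "nat \<Rightarrow> (nat \<Rightarrow> nat \<Rightarrow> int) \<Rightarrow> bool" where
  "signed_graph n S \<longleftrightarrow> (\<forall>u v. S u v \<in> {-1, 0, 1}) \<and> (\<forall>u v. S u v = S v u) \<and> (\<forall>u. S u u = 0)"

definition adj :: "nat \<Rightarrow> (nat \<Rightarrow> nat \<Rightarrow> int) \<Rightarrow> nat \<Rightarrow> nat \<Rightarrow> bool" where
  "adj n S u v \<longleftrightarrow> u < n \<and> v < n \<and> S u v \<noteq> 0"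

definition adj_matrix :: "nat \<Rightarrow> (nat \<Rightarrow> nat \<Rightarrow> int) \<Rightarrow> real mat" where
  "adj_matrix n S = mat n n (\<lambda>(i, j). real_of_int (S i j))"

definition neg_inertia :: "real mat \<Rightarrow> nat" where
  "neg_inertia A = (\<Sum>x\<in>{x. x < 0 \<and> poly (char_poly A) x = 0}. order x (char_poly A))"

definition connected_sg :: "nat \<Rightarrow> (nat \<Rightarrow> nat \<Rightarrow> int) \<Rightarrow> bool" where
  "connected_sg n S \<longleftrightarrow> 0 < n \<and> (\<forall>u<n. \<forall>v<n. (adj n S)\<^sup>*\<^sup>* u v)"

definition is_cycle :: "nat \<Rightarrow> (nat \<Rightarrow> nat \<Rightarrow> int) \<Rightarrow> nat list \<Rightarrow> bool" where
  "is_cycle n S c \<longleftrightarrow> 3 \<le> length c \<and> distinct c \<and>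
     (\<forall>i < length c. adj n S (c ! i) (c ! ((i + 1) mod length c)))"

definition cycle_sign :: "(nat \<Rightarrow> nat \<Rightarrow> int) \<Rightarrow> nat list \<Rightarrow> int" where
  "cycle_sign S c = (\<Prod>i<length c. S (c ! i) (c ! ((i + 1) mod length c)))"

definition balanced :: "nat \<Rightarrow> (nat \<Rightarrow> nat \<Rightarrow> int) \<Rightarrow> bool" where
  "balanced n S \<longleftrightarrow> (\<forall>c. is_cycle n S c \<longrightarrow> cycle_sign S c = 1)"

definition has_cycle :: "nat \<Rightarrow> (nat \<Rightarrow> nat \<Rightarrow> int) \<Rightarrow> bool" where
  "has_cycle n S \<longleftrightarrow> (\<exists>c. is_cycle n S c)"

definition girth :: "nat \<Rightarrow> (nat \<Rightarrow> nat \<Rightarrow> int) \<Rightarrow> nat" where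
  "girth n S = (LEAST k. \<exists>c. is_cycle n S c \<and> length c = k)"

definition cycle_edge :: "nat list \<Rightarrow> nat \<Rightarrow> nat \<Rightarrow> bool" where
  "cycle_edge c u v \<longleftrightarrow> (\<exists>i < length c.
     (u = c ! i \<and> v = c ! ((i + 1) mod length c)) \<or> (v = c ! i \<and> u = c ! ((i + 1) mod length c)))"

definition graph_is_cycle :: "nat \<Rightarrow> (nat \<Rightarrow> nat \<Rightarrow> int) \<Rightarrow> nat list \<Rightarrow> bool" where
  "graph_is_cycle n S c \<longleftrightarrow> set c = {..<n} \<and> (\<forall>u v. adj n S u v \<longleftrightarrow> cycle_edge c u v)"

definition switching_equiv :: "nat \<Rightarrow> (nat \<Rightarrow> nat \<Rightarrow> int) \<Rightarrow> (nat \<Rightarrow> nat \<Rightarrow> int) \<Rightarrow> bool" where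
  "switching_equiv n S T \<longleftrightarrow> (\<exists>\<theta> :: nat \<Rightarrow> int. (\<forall>u<n. \<theta> u \<in> {-1, 1}) \<and>
      (\<forall>u<n. \<forall>v<n. T u v = \<theta> u * S u v * \<theta> v))"

definition complete_multipartite :: "nat \<Rightarrow> (nat \<Rightarrow> nat \<Rightarrow> int) \<Rightarrow> nat \<Rightarrow> bool" where
  "complete_multipartite n S l \<longleftrightarrow> (\<exists>p :: nat \<Rightarrow> nat. (\<forall>u<n. p u < l) \<and> (\<forall>k<l. \<exists>u<n. p u = k) \<and>
      (\<forall>u<n. \<forall>v<n. adj n S u v \<longleftrightarrow> p u \<noteq> p v))"

definition pos_complete_bipartite :: "nat \<Rightarrow> (nat \<Rightarrow> nat \<Rightarrow> int) \<Rightarrow> bool" where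
  "pos_complete_bipartite n T \<longleftrightarrow> complete_multipartite n T 2 \<and>
      (\<forall>u<n. \<forall>v<n. adj n T u v \<longrightarrow> T u v = 1)"

end

theory Submission
  imports Defs
begin

text \<open>Let m = \<lceil>g/2\<rceil> - 1. On a shortest cycle the vertices 1, 3, ..., 2m-1 span an isotropic
  subspace that pairs triangularly with the vertices 2, 4, ..., 2m, so it meets the radical
  trivially and forces at least m negative eigenvalues. If g \<ge> 5 and the graph is not a cycle, an outside
  vertex with its unique neighbour on the cycle extends this family by one. If the graph
  is the cycle, the form on the orthogonal complement of the isotropic subspace is \<plusminus>2xx or a multiple
  of a product xy, and the sign of the cycle decides between m and m+1. If g \<le> 4 then m = 1, and with
  a single negative eigenvalue every isotropic vector orthogonal to a negative one lies in the
  radical: hence non-adjacency is transitive, non-adjacent vertices have proportional rows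
  and triangles are negative.\<close>

section \<open>Inertia of real symmetric matrices\<close>

text \<open>\<open>neg_inertia\<close> counts roots of the characteristic polynomial with
  multiplicity and says nothing directly about vertices. Orthogonal diagonalization turns it into a
  statement about quadratic forms, where both bounds come from a homogeneous system with fewer
  equations than unknowns. Isotropic vectors are chosen because an independent set of vertices
  supplies them whatever the signs are; the signs matter only for what is left on the orthogonal
  complement, so no spectrum of a path or cycle is ever computed. The threshold g = 5 is where an
  outside vertex can no longer have two neighbours on a shortest cycle; K_{2,3} shows that it can
  for g = 4. For the converse in the multipartite case, the signs between different parts can be
  written as -\<theta>(u)\<theta>(v), and then the form is a sum of squares minus a single
  square.\<close>

lemma nontrivial_solution:
  fixes B :: "'a \<Rightarrow> 'b \<Rightarrow> real"
  assumes "finite I" "finite J" "card I < card J"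
  shows "\<exists>a. (\<exists>j\<in>J. a j \<noteq> 0) \<and> (\<forall>i\<in>I. (\<Sum>j\<in>J. B i j * a j) = 0)"
  using assms
proof (induction I arbitrary: J B rule: finite_induct)
  case empty
  then have "J \<noteq> {}" by auto
  then show ?case by (intro exI[of _ "\<lambda>_. 1"]) auto
next
  case (insert i I)
  show ?case
  proof (cases "\<forall>j\<in>J. B i j = 0")
    case True
    obtain a where "\<exists>j\<in>J. a j \<noteq> 0" "\<forall>i\<in>I. (\<Sum>j\<in>J. B i j * a j) = 0"
      using insert.IH[of J B] insert.prems insert.hyps by auto
    with True show ?thesis by (intro exI[of _ a]) auto
  next
    case False
    then obtain p where p: "p \<in> J" "B i p \<noteq> 0" by auto
    define K where "K = J - {p}"
    have K: "finite K" "p \<notin> K" "J = insert p K" "card I < card K"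
      using insert p by (auto simp: K_def card_Diff_singleton)
    \<comment> \<open>One step of Gaussian elimination: equation \<open>i\<close> is solved for the
      unknown \<open>p\<close>, and \<open>C\<close> is the system that remains after substitution.
      The vector \<open>b\<close> below restores the coordinate \<open>p\<close>.\<close>
    define C where "C r j = B r j - B r p * B i j / B i p" for r j
    obtain a where a: "\<exists>j\<in>K. a j \<noteq> 0" "\<forall>i\<in>I. (\<Sum>j\<in>K. C i j * a j) = 0"
      using insert.IH[OF K(1,4), of C] by auto
    define b where "b = a(p := - (\<Sum>j\<in>K. B i j * a j) / B i p)"
    have sb: "(\<Sum>j\<in>K. B r j * b j) = (\<Sum>j\<in>K. B r j * a j)" for r
      using K(2) by (intro sum.cong) (auto simp: b_def)
    have "(\<Sum>j\<in>J. B i j * b j) = 0"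
      using K(1,2) p(2) by (simp add: K(3) sb) (simp add: b_def)
    moreover have "(\<Sum>j\<in>J. B r j * b j) = 0" if "r \<in> I" for r
    proof -
      have "(\<Sum>j\<in>K. C r j * a j) = (\<Sum>j\<in>K. B r j * a j) - B r p / B i p * (\<Sum>j\<in>K. B i j * a j)"
        by (simp add: C_def algebra_simps sum_subtractf sum_distrib_left)
      then have "(\<Sum>j\<in>K. B r j * a j) = B r p / B i p * (\<Sum>j\<in>K. B i j * a j)"
        using a(2) that by simp
      then show ?thesis
        using K(1,2) by (simp add: K(3) sb) (simp add: b_def)
    qed
    moreover have "\<exists>j\<in>J. b j \<noteq> 0"
      using a(1) K by (auto simp: b_def)
    ultimately show ?thesis by blast
  qed
qed

section \<open>Orthogonal diagonalization of real symmetric matrices\<close>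

lemma symmetric_real_eigenvalue:
  fixes A :: "real mat"
  assumes A: "A \<in> carrier_mat n n" and sym: "transpose_mat A = A" and n: "0 < n"
  obtains e where "eigenvalue A e"
proof -
  define C where "C = map_mat complex_of_real A"
  have C: "C \<in> carrier_mat n n" using A by (auto simp: C_def)
  have sym': "A $$ (i, j) = A $$ (j, i)" if "i < n" "j < n" for i j
    using that A arg_cong[OF sym, of "\<lambda>M. M $$ (i, j)"] by simp
  obtain as where as: "char_poly C = (\<Prod>a\<leftarrow>as. [:- a, 1:])" "length as = n"
    using char_poly_factorized[OF C] by auto
  then obtain a where "a \<in> set as" using n by (cases as) auto
  then have root: "poly (char_poly C) a = 0"
    unfolding as(1) poly_prod_list prod_list_zero_iff by auto
  then obtain v where v: "v \<in> carrier_vec n" "v \<noteq> 0\<^sub>v n" "C *\<^sub>v v = a \<cdot>\<^sub>v v"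
    unfolding eigenvalue_root_char_poly[OF C, symmetric] eigenvalue_def eigenvector_def
    using C by auto
  have row: "(\<Sum>j<n. A $$ (i, j) * (v $ j)) = a * v $ i" if "i < n" for i
    using arg_cong[OF v(3), of "\<lambda>w. w $ i"] that C v(1) A
    by (simp add: scalar_prod_def C_def lessThan_atLeast0)
  define x where "x i = Re (v $ i)" for i
  define y where "y i = Im (v $ i)" for i
  have rx: "(\<Sum>j<n. A $$ (i, j) * x j) = Re a * x i - Im a * y i" if "i < n" for i
    using arg_cong[OF row[OF that], of Re] by (simp add: x_def y_def)
  have ry: "(\<Sum>j<n. A $$ (i, j) * y j) = Re a * y i + Im a * x i" if "i < n" for i
    using arg_cong[OF row[OF that], of Im] by (simp add: x_def y_def)
  \<comment> \<open>For an eigenvector v = x + iy of the complexified matrix, symmetry gives y.Ax =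
    x.Ay. Evaluating both sides by \<open>rx\<close> and \<open>ry\<close> leaves Im a times |x|^2 +
    |y|^2 equal to 0.\<close>
  have "(\<Sum>i<n. y i * (\<Sum>j<n. A $$ (i, j) * x j)) = (\<Sum>i<n. \<Sum>j<n. y i * A $$ (i, j) * x j)"
    by (simp add: sum_distrib_left mult.assoc)
  also have "\<dots> = (\<Sum>j<n. \<Sum>i<n. y i * A $$ (i, j) * x j)" by (rule sum.swap)
  also have "\<dots> = (\<Sum>j<n. x j * (\<Sum>i<n. A $$ (j, i) * y i))"
    by (intro sum.cong) (auto simp: sum_distrib_left sym' mult_ac intro!: sum.cong)
  finally have "(\<Sum>i<n. y i * (Re a * x i - Im a * y i)) = (\<Sum>j<n. x j * (Re a * y j + Im a * x j))"
    by (simp add: rx ry)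
  then have "Im a * (\<Sum>i<n. (x i)\<^sup>2 + (y i)\<^sup>2) = 0"
    by (simp add: algebra_simps sum.distrib sum_subtractf sum_distrib_left power2_eq_square)
  moreover have "(\<Sum>i<n. (x i)\<^sup>2 + (y i)\<^sup>2) \<noteq> 0"
  proof
    assume "(\<Sum>i<n. (x i)\<^sup>2 + (y i)\<^sup>2) = 0"
    then have "\<forall>i<n. (x i)\<^sup>2 + (y i)\<^sup>2 = 0"
      by (subst (asm) sum_nonneg_eq_0_iff) auto
    then have "v = 0\<^sub>v n"
      using v(1) by (intro eq_vecI) (auto simp: x_def y_def complex_eq_iff sum_power2_eq_zero_iff)
    with v(2) show False ..
  qed
  ultimately have a: "a = complex_of_real (Re a)" by (simp add: complex_eq_iff)
  have "complex_of_real (poly (char_poly A) (Re a)) = 0"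
    using root unfolding C_def of_real_hom.char_poly_hom[OF A]
    by (subst (asm) a) simp
  then have "eigenvalue A (Re a)"
    unfolding eigenvalue_root_char_poly[OF A] by simp
  then show thesis by (rule that)
qed

text \<open>The reflection in the hyperplane orthogonal to w = u - e_0 interchanges the unit vectors
  u and e_0. Being symmetric and its own inverse, it replaces the completion of \<open>u\<close> to
  an orthonormal basis.\<close>

lemma householder:
  fixes u :: "real vec"
  assumes u: "u \<in> carrier_vec n" "u \<bullet> u = 1" and n: "0 < n"
  obtains W where "W \<in> carrier_mat n n" "transpose_mat W = W" "W * W = 1\<^sub>m n" "W *\<^sub>v unit_vec n 0 = u"
proof (cases "u = unit_vec n 0")
  case True
  then show thesis using that[of "1\<^sub>m n"] u by auto
next
  case False
  define w where "w i = u $ i - (if i = 0 then 1 else 0)" for i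
  define s where "s = (\<Sum>i<n. (w i)\<^sup>2)"
  have uu: "(\<Sum>i<n. u $ i * u $ i) = 1"
    using u by (simp add: scalar_prod_def lessThan_atLeast0)
  \<comment> \<open>Since |u| = 1, the squared norm of w is linear in u_0. This gives w_0 = -s/2,
    which turns the first column of \<open>W\<close> into e_0 + w = u.\<close>
  have "s = (\<Sum>i<n. u $ i * u $ i + (if i = 0 then 1 - 2 * u $ 0 else 0))"
    unfolding s_def by (intro sum.cong) (auto simp: w_def power2_eq_square algebra_simps)
  also have "\<dots> = 2 - 2 * u $ 0" using n uu by (simp add: sum.distrib)
  finally have s: "s = 2 - 2 * u $ 0" .
  have "s \<noteq> 0"
  proof
    assume "s = 0"
    then have "\<forall>i<n. w i = 0" unfolding s_def by (subst (asm) sum_nonneg_eq_0_iff) auto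
    then have "u = unit_vec n 0" using u(1) by (intro eq_vecI) (auto simp: w_def)
    with False show False ..
  qed
  define W where "W = mat n n (\<lambda>(i, j). (if i = j then 1 else 0) - 2 / s * w i * w j)"
  have W: "W \<in> carrier_mat n n" by (simp add: W_def)
  have "W * W = 1\<^sub>m n"
  proof (rule eq_matI)
    fix i j assume "i < dim_row (1\<^sub>m n)" "j < dim_col (1\<^sub>m n)"
    then have ij: "i < n" "j < n" by auto
    have "(W * W) $$ (i, j) = (\<Sum>k<n. ((if i = k then 1 else 0) - 2 / s * w i * w k) * ((if k = j then 1 else 0) - 2 / s * w k * w j))"
      using ij by (simp add: W_def scalar_prod_def lessThan_atLeast0)
    also have "\<dots> = (\<Sum>k<n. (if k = i then (if i = j then 1 else 0) - 2 / s * w i * w j else 0)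
        - (if k = j then 2 / s * w i * w j else 0) + (2 / s)\<^sup>2 * w i * w j * (w k)\<^sup>2)"
      by (intro sum.cong) (auto simp: algebra_simps power2_eq_square)
    also have "\<dots> = (if i = j then 1 else 0) - 2 / s * w i * w j - 2 / s * w i * w j + (2 / s)\<^sup>2 * w i * w j * s"
      using ij by (simp add: sum.distrib sum_subtractf sum_distrib_left[symmetric] s_def)
    also have "\<dots> = (if i = j then 1 else 0)"
      using \<open>s \<noteq> 0\<close> by (simp add: power2_eq_square field_simps)
    finally show "(W * W) $$ (i, j) = 1\<^sub>m n $$ (i, j)" using ij by simp
  qed (auto simp: W_def)
  moreover have "W *\<^sub>v unit_vec n 0 = u"
  proof (rule eq_vecI)
    fix i assume "i < dim_vec u"
    then have i: "i < n" using u by simp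
    have "(W *\<^sub>v unit_vec n 0) $ i = (if i = 0 then 1 else 0) - 2 / s * w i * w 0"
      using i n by (simp add: W_def)
    also have "w 0 = - s / 2" by (simp add: w_def s)
    finally show "(W *\<^sub>v unit_vec n 0) $ i = u $ i"
      using \<open>s \<noteq> 0\<close> by (simp add: w_def field_simps)
  qed (use u in \<open>auto simp: W_def\<close>)
  moreover have "transpose_mat W = W" by (rule eq_matI) (auto simp: W_def)
  ultimately show thesis using that W by blast
qed

lemma four_block_diag_mult:
  fixes A B :: "real mat"
  assumes "a \<in> carrier_mat 1 1" "b \<in> carrier_mat 1 1" "A \<in> carrier_mat m m" "B \<in> carrier_mat m m"
  shows "four_block_mat a (0\<^sub>m 1 m) (0\<^sub>m m 1) A * four_block_mat b (0\<^sub>m 1 m) (0\<^sub>m m 1) B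
    = four_block_mat (a * b) (0\<^sub>m 1 m) (0\<^sub>m m 1) (A * B)"
  by (subst mult_four_block_mat[OF assms(1) _ _ assms(3) assms(2) _ _ assms(4)]) (use assms in auto)

text \<open>Deflation: conjugation by a reflection that sends e_0 to a unit eigenvector makes the
  first column a multiple of e_0. By symmetry the first row is one too, and the remaining block is a
  smaller symmetric matrix.\<close>

theorem symmetric_orthogonally_diagonalizable:
  fixes A :: "real mat"
  assumes "A \<in> carrier_mat n n" "transpose_mat A = A"
  shows "\<exists>P D. P \<in> carrier_mat n n \<and> D \<in> carrier_mat n n \<and> diagonal_mat D \<and>
    transpose_mat P * P = 1\<^sub>m n \<and> A = P * D * transpose_mat P"
  using assms
proof (induction n arbitrary: A)
  case 0
  then show ?case
    by (intro exI[of _ "1\<^sub>m 0"]) (auto simp: diagonal_mat_def intro!: exI[of _ "1\<^sub>m 0"])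
next
  case (Suc m)
  note A = Suc.prems(1) and sym = Suc.prems(2)
  let ?n = "Suc m"
  obtain e where "eigenvalue A e" using symmetric_real_eigenvalue[OF A sym] by auto
  then obtain v where v: "v \<in> carrier_vec ?n" "v \<noteq> 0\<^sub>v ?n" "A *\<^sub>v v = e \<cdot>\<^sub>v v"
    unfolding eigenvalue_def eigenvector_def using A by auto
  define u where "u = (1 / sqrt (v \<bullet> v)) \<cdot>\<^sub>v v"
  have pos: "v \<bullet> v > 0"
    using conjugate_square_greater_0_vec[OF v(1)] v(2) by simp
  have u: "u \<in> carrier_vec ?n" using v by (simp add: u_def)
  have uu: "u \<bullet> u = 1"
    using v(1) pos by (simp add: u_def)
  have Au: "A *\<^sub>v u = e \<cdot>\<^sub>v u"
    using A v by (simp add: u_def mult_mat_vec smult_smult_assoc mult.commute)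
  obtain W where W: "W \<in> carrier_mat ?n ?n" "transpose_mat W = W" "W * W = 1\<^sub>m ?n"
      "W *\<^sub>v unit_vec ?n 0 = u"
    using householder[OF u uu] by auto
  define B where "B = W * A * W"
  have B: "B \<in> carrier_mat ?n ?n" using W A by (simp add: B_def)
  have WBW: "W * B * W = A"
  proof -
    have "W * B * W = (W * W) * A * (W * W)"
      unfolding B_def using W(1) A by (simp add: assoc_mult_mat[of _ ?n ?n _ ?n _ ?n])
    then show ?thesis using W(3) A by simp
  qed
  have symB: "transpose_mat B = B"
    unfolding B_def using W(1,2) A sym
    by (simp add: transpose_mult[of _ ?n ?n _ ?n] assoc_mult_mat[of _ ?n ?n _ ?n _ ?n])
  have "W *\<^sub>v u = unit_vec ?n 0"
    unfolding W(4)[symmetric] using W(1,3) by (simp flip: assoc_mult_mat_vec)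
  then have "B *\<^sub>v unit_vec ?n 0 = e \<cdot>\<^sub>v unit_vec ?n 0"
    unfolding B_def using W A u Au
    by (simp add: assoc_mult_mat_vec[of _ ?n ?n _ ?n] mult_mat_vec[of _ ?n ?n])
  then have col0: "B $$ (i, 0) = (if i = 0 then e else 0)" if "i < ?n" for i
  proof -
    have "(B *\<^sub>v unit_vec ?n 0) $ i = B $$ (i, 0)" using that B by simp
    then show ?thesis using \<open>B *\<^sub>v unit_vec ?n 0 = _\<close> that by auto
  qed
  have sB: "B $$ (i, j) = B $$ (j, i)" if "i < ?n" "j < ?n" for i j
    using that B arg_cong[OF symB, of "\<lambda>M. M $$ (i, j)"] by simp
  define C where "C = mat m m (\<lambda>(i, j). B $$ (Suc i, Suc j))"
  define E where "E = mat 1 1 (\<lambda>_. e)"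
  have C: "C \<in> carrier_mat m m" and E: "E \<in> carrier_mat 1 1" by (auto simp: C_def E_def)
  have Bblock: "B = four_block_mat E (0\<^sub>m 1 m) (0\<^sub>m m 1) C"
  proof (rule eq_matI)
    fix i j assume "i < dim_row (four_block_mat E (0\<^sub>m 1 m) (0\<^sub>m m 1) C)"
      "j < dim_col (four_block_mat E (0\<^sub>m 1 m) (0\<^sub>m m 1) C)"
    then have ij: "i < ?n" "j < ?n" using C E by auto
    have C0: "B $$ (i, 0) = (if i = 0 then e else 0)" "B $$ (0, j) = (if j = 0 then e else 0)"
      using col0 sB[of 0 j] ij by auto
    show "B $$ (i, j) = four_block_mat E (0\<^sub>m 1 m) (0\<^sub>m m 1) C $$ (i, j)"
      using ij C0 C E by (cases i; cases j) (auto simp: C_def E_def)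
  qed (use B C E in auto)
  have "transpose_mat C = C"
    by (rule eq_matI) (auto simp: C_def sB)
  then obtain P D where P: "P \<in> carrier_mat m m" and D: "D \<in> carrier_mat m m" "diagonal_mat D"
      and PD: "transpose_mat P * P = 1\<^sub>m m" "C = P * D * transpose_mat P"
    using Suc.IH[OF C] by blast
  define R where "R = four_block_mat (1\<^sub>m 1) (0\<^sub>m 1 m) (0\<^sub>m m 1) P"
  define F where "F = four_block_mat E (0\<^sub>m 1 m) (0\<^sub>m m 1) D"
  have R: "R \<in> carrier_mat ?n ?n" and F: "F \<in> carrier_mat ?n ?n"
    using P D E by (auto simp: R_def F_def)
  have RT: "transpose_mat R = four_block_mat (1\<^sub>m 1) (0\<^sub>m 1 m) (0\<^sub>m m 1) (transpose_mat P)"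
    unfolding R_def by (subst transpose_four_block_mat[of _ 1 1 _ m _ m]) (use P in \<open>auto simp: transpose_one zero_transpose_mat\<close>)
  have RR: "transpose_mat R * R = 1\<^sub>m ?n"
    unfolding RT unfolding R_def using P PD
    by (subst four_block_diag_mult) (auto intro!: eq_matI)
  have RF: "R * F * transpose_mat R = B"
    unfolding RT F_def Bblock PD(2) unfolding R_def using P D E
    by (simp add: four_block_diag_mult[unfolded One_nat_def])
  have diagF: "diagonal_mat F"
    using D E unfolding diagonal_mat_def F_def by auto
  have RT': "transpose_mat R \<in> carrier_mat ?n ?n" using R by simp
  have "transpose_mat (W * R) * (W * R) = transpose_mat R * (W * W) * R"
    using W(1,2) R RT' by (simp add: transpose_mult[of _ ?n ?n _ ?n] assoc_mult_mat[of _ ?n ?n _ ?n _ ?n])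
  then have "transpose_mat (W * R) * (W * R) = 1\<^sub>m ?n" using W RR R RT' by simp
  moreover have "(W * R) * F * transpose_mat (W * R) = W * (R * F * transpose_mat R) * W"
    using W(1,2) R F RT' by (simp add: transpose_mult[of _ ?n ?n _ ?n] assoc_mult_mat[of _ ?n ?n _ ?n _ ?n])
  ultimately show ?case
    using W(1) R F diagF WBW RF by (intro exI[of _ "W * R"] exI[of _ F]) auto
qed

section \<open>Negative eigenvalues counted with multiplicity\<close>

lemma order_prod_linear_factors:
  fixes x :: real
  shows "order x (\<Prod>a\<leftarrow>es. [:- a, 1:]) = count (mset es) x"
proof (induction es)
  case (Cons a es)
  have "(\<Prod>a\<leftarrow>es. [:- a, 1:]) \<noteq> 0" by (auto simp: prod_list_zero_iff)
  then have "[:- a, 1:] * (\<Prod>a\<leftarrow>es. [:- a, 1:]) \<noteq> 0" by (simp del: mult_pCons_left)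
  from order_mult[OF this, of x] show ?case
    using Cons order_linear_power[of x "- a" 1] by (simp del: mult_pCons_left)
qed auto

lemma neg_inertia_linear_factors:
  assumes "char_poly A = (\<Prod>a\<leftarrow>es. [:- a, 1:])"
  shows "neg_inertia A = length (filter (\<lambda>x. x < 0) es)"
proof -
  have "{x. x < 0 \<and> poly (char_poly A) x = 0} = set_mset (filter_mset (\<lambda>x. x < 0) (mset es))"
    unfolding assms by (auto simp: poly_prod_list prod_list_zero_iff)
  then have "neg_inertia A = (\<Sum>x\<in>set_mset (filter_mset (\<lambda>x. x < 0) (mset es)).
      count (filter_mset (\<lambda>x. x < 0) (mset es)) x)"
    unfolding neg_inertia_def by (intro sum.cong) (auto simp: assms order_prod_linear_factors)
  also have "\<dots> = size (filter_mset (\<lambda>x. x < 0) (mset es))"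
    by (simp add: size_multiset_overloaded_eq)
  finally show ?thesis by (simp add: size_mset[symmetric] del: size_mset)
qed

text \<open>Passage from matrices to finite sums over functions, in which all later arguments are
  carried out. The \<open>V k\<close> form an orthonormal eigenbasis with eigenvalues
  \<open>d k\<close>; the count holds because the matrix is similar to its diagonal form.\<close>

lemma spectral_decomposition:
  fixes M :: "nat \<Rightarrow> nat \<Rightarrow> real"
  assumes sym: "\<And>i j. i < n \<Longrightarrow> j < n \<Longrightarrow> M i j = M j i"
  obtains d V where
    "\<And>i j. i < n \<Longrightarrow> j < n \<Longrightarrow> M i j = (\<Sum>k<n. d k * V k i * V k j)"
    "\<And>k l. k < n \<Longrightarrow> l < n \<Longrightarrow> (\<Sum>i<n. V k i * V l i) = (if k = l then 1 else 0)"
    "neg_inertia (mat n n (\<lambda>(i, j). M i j)) = card {k. k < n \<and> d k < 0}"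
proof -
  define A where "A = mat n n (\<lambda>(i, j). M i j)"
  have A: "A \<in> carrier_mat n n" "transpose_mat A = A"
    using sym by (auto simp: A_def intro!: eq_matI)
  obtain P D where P: "P \<in> carrier_mat n n" and D: "D \<in> carrier_mat n n" "diagonal_mat D"
    and PD: "transpose_mat P * P = 1\<^sub>m n" "A = P * D * transpose_mat P"
    using symmetric_orthogonally_diagonalizable[OF A] by blast
  define d where "d k = D $$ (k, k)" for k
  define V where "V k i = P $$ (i, k)" for k i
  have D0: "D $$ (i, k) = (if i = k then d k else 0)" if "i < n" "k < n" for i k
    using D that by (auto simp: d_def diagonal_mat_def)
  have "M i j = (\<Sum>k<n. d k * V k i * V k j)" if ij: "i < n" "j < n" for i j
  proof -
    have PDk: "(P * D) $$ (i, k) = P $$ (i, k) * d k" if "k < n" for k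
    proof -
      have "(P * D) $$ (i, k) = (\<Sum>l<n. P $$ (i, l) * D $$ (l, k))"
        using P D ij that by (simp add: scalar_prod_def lessThan_atLeast0)
      also have "\<dots> = (\<Sum>l<n. if l = k then P $$ (i, k) * d k else 0)"
        using that by (intro sum.cong) (auto simp: D0)
      finally show ?thesis using that by simp
    qed
    have "M i j = A $$ (i, j)" using ij by (simp add: A_def)
    also have "\<dots> = row (P * D) i \<bullet> col (transpose_mat P) j"
      unfolding PD(2) using P D ij by (subst index_mult_mat) auto
    also have "\<dots> = (\<Sum>k<n. (P * D) $$ (i, k) * P $$ (j, k))"
      unfolding scalar_prod_def lessThan_atLeast0
      using P D ij by (intro sum.cong) auto
    also have "\<dots> = (\<Sum>k<n. d k * V k i * V k j)"
      by (intro sum.cong) (auto simp: PDk V_def mult_ac)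
    finally show ?thesis .
  qed
  moreover have "(\<Sum>i<n. V k i * V l i) = (if k = l then 1 else 0)" if "k < n" "l < n" for k l
  proof -
    have "(\<Sum>i<n. V k i * V l i) = (transpose_mat P * P) $$ (k, l)"
      using P that by (simp add: scalar_prod_def V_def lessThan_atLeast0)
    then show ?thesis using that by (simp add: PD)
  qed
  moreover have "neg_inertia A = card {k. k < n \<and> d k < 0}"
  proof -
    have PT: "transpose_mat P \<in> carrier_mat n n" using P by simp
    have "P * transpose_mat P = 1\<^sub>m n" by (rule mat_mult_left_right_inverse[OF PT P PD(1)])
    then have "similar_mat A D"
      unfolding similar_mat_def similar_mat_wit_def Let_def
      using P D A PD PT by (intro exI[of _ P] exI[of _ "transpose_mat P"]) auto
    then have "char_poly A = char_poly D" by (rule char_poly_similar)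
    also have "\<dots> = (\<Prod>a\<leftarrow>diag_mat D. [:- a, 1:])"
      using D by (intro char_poly_upper_triangular[of _ n]) (auto simp: diagonal_mat_def)
    finally have "neg_inertia A = length (filter (\<lambda>x. x < 0) (diag_mat D))"
      by (rule neg_inertia_linear_factors)
    also have "\<dots> = length (filter (\<lambda>k. d k < 0) [0..<n])"
      using D by (simp add: diag_mat_def filter_map o_def d_def)
    also have "\<dots> = card {k. k < n \<and> d k < 0}"
      by (simp add: length_filter_conv_card cong: conj_cong)
    finally show ?thesis .
  qed
  ultimately show thesis using that[of d V] by (simp add: A_def)
qed

section \<open>Inertia of quadratic forms\<close>

text \<open>Vectors are total functions on the naturals of which only the values below
  \<open>n\<close> enter \<open>app\<close> and \<open>bil\<close>, so no dimension conditions have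
  to be carried along.\<close>

locale symmetric_form =
  fixes n :: nat and M :: "nat \<Rightarrow> nat \<Rightarrow> real"
  assumes sym: "i < n \<Longrightarrow> j < n \<Longrightarrow> M i j = M j i"
begin

definition app :: "(nat \<Rightarrow> real) \<Rightarrow> nat \<Rightarrow> real" where
  "app x i = (\<Sum>j<n. M i j * x j)"

definition bil :: "(nat \<Rightarrow> real) \<Rightarrow> (nat \<Rightarrow> real) \<Rightarrow> real" where
  "bil x y = (\<Sum>i<n. x i * app y i)"

definition ev :: "nat \<Rightarrow> nat \<Rightarrow> real" where
  "ev u i = (if i = u then 1 else 0)"

abbreviation neg :: nat where
  "neg \<equiv> neg_inertia (mat n n (\<lambda>(i, j). M i j))"

lemma app_ev: "u < n \<Longrightarrow> app (ev u) r = M r u"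
  by (simp add: app_def ev_def if_distrib cong: if_cong)

lemma app_add: "app (\<lambda>i. x i + y i) r = app x r + app y r"
  by (simp add: app_def algebra_simps sum.distrib)

lemma app_diff: "app (\<lambda>i. x i - y i) r = app x r - app y r"
  by (simp add: app_def algebra_simps sum_subtractf)

lemma app_scale: "app (\<lambda>i. a * x i) r = a * app x r"
  by (simp add: app_def algebra_simps sum_distrib_left)

lemma app_sum: "app (\<lambda>i. \<Sum>j\<in>J. f j i) r = (\<Sum>j\<in>J. app (f j) r)"
  unfolding app_def sum_distrib_left by (rule sum.swap)

lemmas app_linear = app_add app_diff app_scale app_sum

lemma bil_commute: "bil x y = bil y x"
proof -
  have "bil x y = (\<Sum>i<n. \<Sum>j<n. x i * M i j * y j)"
    by (simp add: bil_def app_def sum_distrib_left mult.assoc)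
  also have "\<dots> = (\<Sum>j<n. \<Sum>i<n. x i * M i j * y j)" by (rule sum.swap)
  also have "\<dots> = bil y x"
    unfolding bil_def app_def sum_distrib_left by (intro sum.cong) (auto simp: sym mult_ac)
  finally show ?thesis .
qed

lemma bil_ev: "u < n \<Longrightarrow> bil (ev u) y = app y u"
  by (simp add: bil_def ev_def if_distrib[of "\<lambda>a. a * _"] cong: if_cong)

lemma bil_add: "bil (\<lambda>i. x i + y i) z = bil x z + bil y z"
  by (simp add: bil_def algebra_simps sum.distrib)

lemma bil_diff: "bil (\<lambda>i. x i - y i) z = bil x z - bil y z"
  by (simp add: bil_def algebra_simps sum_subtractf)

lemma bil_scale: "bil (\<lambda>i. a * x i) z = a * bil x z"
  by (simp add: bil_def algebra_simps sum_distrib_left)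

lemma bil_sum: "bil (\<lambda>i. \<Sum>j\<in>J. f j i) z = (\<Sum>j\<in>J. bil (f j) z)"
  unfolding bil_def sum_distrib_right by (rule sum.swap)

lemmas bil_linear = bil_add bil_diff bil_scale bil_sum

lemma bil_eq_0: "(\<And>r. r < n \<Longrightarrow> app y r = 0) \<Longrightarrow> bil x y = 0"
  by (simp add: bil_def)

lemma spectral:
  obtains d V where
    "\<And>x r. r < n \<Longrightarrow> app x r = (\<Sum>k<n. d k * (\<Sum>i<n. V k i * x i) * V k r)"
    "\<And>x. bil x x = (\<Sum>k<n. d k * (\<Sum>i<n. V k i * x i)\<^sup>2)"
    "\<And>k l. k < n \<Longrightarrow> l < n \<Longrightarrow> (\<Sum>i<n. V k i * V l i) = (if k = l then 1 else 0)"
    "neg = card {k. k < n \<and> d k < 0}"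
proof -
  obtain d V where dV: "\<And>i j. i < n \<Longrightarrow> j < n \<Longrightarrow> M i j = (\<Sum>k<n. d k * V k i * V k j)"
    "\<And>k l. k < n \<Longrightarrow> l < n \<Longrightarrow> (\<Sum>i<n. V k i * V l i) = (if k = l then 1 else 0)"
    "neg = card {k. k < n \<and> d k < 0}"
    by (rule spectral_decomposition[of n M]) (erule (1) sym, rule that)
  have app: "app x r = (\<Sum>k<n. d k * (\<Sum>i<n. V k i * x i) * V k r)" if "r < n" for x r
  proof -
    have "app x r = (\<Sum>i<n. \<Sum>k<n. d k * V k r * V k i * x i)"
      unfolding app_def using that by (intro sum.cong) (auto simp: dV(1) sum_distrib_right)
    also have "\<dots> = (\<Sum>k<n. \<Sum>i<n. d k * V k r * V k i * x i)" by (rule sum.swap)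
    finally show ?thesis by (simp add: sum_distrib_left sum_distrib_right mult_ac)
  qed
  have "bil x x = (\<Sum>k<n. d k * (\<Sum>i<n. V k i * x i)\<^sup>2)" for x
  proof -
    have "bil x x = (\<Sum>r<n. \<Sum>k<n. d k * (\<Sum>i<n. V k i * x i) * (V k r * x r))"
      unfolding bil_def by (intro sum.cong) (auto simp: app sum_distrib_left mult_ac)
    also have "\<dots> = (\<Sum>k<n. \<Sum>r<n. d k * (\<Sum>i<n. V k i * x i) * (V k r * x r))" by (rule sum.swap)
    finally show ?thesis by (simp add: power2_eq_square mult.assoc flip: sum_distrib_left)
  qed
  then show thesis using that[of d V] app dV by blast
qed

text \<open>The vectors need not be negative for the form: isotropic ones count as long as no nonzero
  combination lies in the radical.\<close>

lemma neg_inertia_ge: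
  assumes f: "\<And>a. \<exists>j<k. a j \<noteq> 0 \<Longrightarrow>
    bil (\<lambda>i. \<Sum>j<k. a j * f j i) (\<lambda>i. \<Sum>j<k. a j * f j i) \<le> 0 \<and>
    (\<exists>r<n. app (\<lambda>i. \<Sum>j<k. a j * f j i) r \<noteq> 0)"
  shows "k \<le> neg"
proof (rule ccontr)
  assume "\<not> k \<le> neg"
  obtain d V where app: "\<And>x r. r < n \<Longrightarrow> app x r = (\<Sum>k<n. d k * (\<Sum>i<n. V k i * x i) * V k r)"
    and bil: "\<And>x. bil x x = (\<Sum>k<n. d k * (\<Sum>i<n. V k i * x i)\<^sup>2)"
    and "\<And>k l. k < n \<Longrightarrow> l < n \<Longrightarrow> (\<Sum>i<n. V k i * V l i) = (if k = l then 1 else 0)"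
    and neg: "neg = card {k. k < n \<and> d k < 0}"
    by (rule spectral) (rule that)
  define I where "I = {l. l < n \<and> d l < 0}"
  have "finite I" "card I < card {..<k}" using \<open>\<not> k \<le> neg\<close> by (auto simp: I_def neg)
  \<comment> \<open>Fewer than \<open>k\<close> conditions on \<open>k\<close> coefficients: some
    nontrivial combination is orthogonal to every eigenvector of negative eigenvalue. Its form is a
    sum of nonnegative terms, so a value \<le> 0 makes each term vanish and puts the combination
    into the radical.\<close>
  then obtain a where a: "\<exists>j\<in>{..<k}. a j \<noteq> 0"
      "\<forall>l\<in>I. (\<Sum>j\<in>{..<k}. (\<Sum>i<n. V l i * f j i) * a j) = 0"
    using nontrivial_solution[of I "{..<k}" "\<lambda>l j. \<Sum>i<n. V l i * f j i"] by auto
  define x where "x i = (\<Sum>j<k. a j * f j i)" for i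
  define y where "y l = (\<Sum>i<n. V l i * x i)" for l
  have "y l = (\<Sum>j<k. (\<Sum>i<n. V l i * f j i) * a j)" for l
  proof -
    have "y l = (\<Sum>i<n. \<Sum>j<k. V l i * f j i * a j)"
      by (simp add: y_def x_def sum_distrib_left mult_ac)
    also have "\<dots> = (\<Sum>j<k. \<Sum>i<n. V l i * f j i * a j)" by (rule sum.swap)
    finally show ?thesis by (simp add: sum_distrib_right)
  qed
  then have y0: "y l = 0" if "l \<in> I" for l using a(2) that by simp
  have nn: "0 \<le> d l * (y l)\<^sup>2" if "l < n" for l
    using y0[of l] that by (cases "l \<in> I") (auto simp: I_def)
  have bx: "bil x x = (\<Sum>l<n. d l * (y l)\<^sup>2)" by (simp add: bil y_def)
  have x: "bil x x \<le> 0" "\<exists>r<n. app x r \<noteq> 0"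
    using f[of a] a(1) unfolding x_def by auto
  have "(\<Sum>l<n. d l * (y l)\<^sup>2) = 0"
    using x(1) bx nn sum_nonneg[of "{..<n}" "\<lambda>l. d l * (y l)\<^sup>2"] by auto
  then have "\<forall>l<n. d l * y l = 0"
    using nn by (subst (asm) sum_nonneg_eq_0_iff) auto
  then have "app x r = 0" if "r < n" for r
    using that by (auto simp: app intro!: sum.neutral simp flip: y_def)
  with x(2) show False by auto
qed

text \<open>The dual count: the form is negative definite on the span of the eigenvectors of
  negative eigenvalue. If its dimension exceeded \<open>k\<close>, that span would meet the common
  kernel of the \<open>k\<close> functionals \<open>L j\<close> outside 0.\<close>

lemma neg_inertia_le:
  assumes L: "\<And>x. \<forall>j<k. (\<Sum>i<n. L j i * x i) = 0 \<Longrightarrow> 0 \<le> bil x x"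
  shows "neg \<le> k"
proof (rule ccontr)
  assume "\<not> neg \<le> k"
  obtain d V where "\<And>x r. r < n \<Longrightarrow> app x r = (\<Sum>k<n. d k * (\<Sum>i<n. V k i * x i) * V k r)"
    and bil: "\<And>x. bil x x = (\<Sum>k<n. d k * (\<Sum>i<n. V k i * x i)\<^sup>2)"
    and orth: "\<And>k l. k < n \<Longrightarrow> l < n \<Longrightarrow> (\<Sum>i<n. V k i * V l i) = (if k = l then 1 else 0)"
    and neg: "neg = card {k. k < n \<and> d k < 0}"
    by (rule spectral) (rule that)
  define I where "I = {l. l < n \<and> d l < 0}"
  have I: "finite I" "card {..<k} < card I" using \<open>\<not> neg \<le> k\<close> by (auto simp: I_def neg)
  then obtain a where a: "\<exists>l\<in>I. a l \<noteq> 0"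
      "\<forall>j\<in>{..<k}. (\<Sum>l\<in>I. (\<Sum>i<n. L j i * V l i) * a l) = 0"
    using nontrivial_solution[of "{..<k}" I "\<lambda>j l. \<Sum>i<n. L j i * V l i"] by auto
  define x where "x i = (\<Sum>l\<in>I. a l * V l i)" for i
  have lin: "(\<Sum>i<n. c i * x i) = (\<Sum>l\<in>I. (\<Sum>i<n. c i * V l i) * a l)" for c
  proof -
    have "(\<Sum>i<n. c i * x i) = (\<Sum>i<n. \<Sum>l\<in>I. c i * V l i * a l)"
      by (simp add: x_def sum_distrib_left mult_ac)
    also have "\<dots> = (\<Sum>l\<in>I. \<Sum>i<n. c i * V l i * a l)" by (rule sum.swap)
    finally show ?thesis by (simp add: sum_distrib_right)
  qed
  have y: "(\<Sum>i<n. V k i * x i) = (if k \<in> I then a k else 0)" if "k < n" for k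
  proof -
    have "(\<Sum>i<n. V k i * x i) = (\<Sum>l\<in>I. if l = k then a l else 0)"
      unfolding lin using that by (intro sum.cong) (auto simp: orth I_def)
    then show ?thesis using I by simp
  qed
  have "bil x x = (\<Sum>k<n. if k \<in> I then d k * (a k)\<^sup>2 else 0)"
    unfolding bil by (intro sum.cong) (auto simp: y)
  also have "\<dots> = (\<Sum>k\<in>I. d k * (a k)\<^sup>2)"
    by (subst sum.inter_restrict[symmetric]) (auto simp: I_def intro!: sum.cong)
  also have "\<dots> < 0"
  proof -
    obtain p where "p \<in> I" "a p \<noteq> 0" using a(1) by auto
    then have "(\<Sum>k\<in>I. d k * (a k)\<^sup>2) < (\<Sum>k\<in>I. 0)"
      using I by (intro sum_strict_mono_ex1) (auto simp: I_def mult_le_0_iff mult_less_0_iff intro!: bexI[of _ p])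
    then show ?thesis by simp
  qed
  finally show False using L[of x] a(2) by (auto simp: lin)
qed

text \<open>Otherwise \<open>x\<close> and \<open>y\<close> would be a family of two for
  \<open>neg_inertia_ge\<close>: a combination involving \<open>x\<close> has negative form, and one
  without \<open>x\<close> is a multiple of \<open>y\<close>. The structure of the graph is later
  read off by exhibiting suitable vectors \<open>y\<close>.\<close>

lemma radical_of_neg_inertia_le_1:
  assumes "neg \<le> 1" "bil x x < 0" "bil x y = 0" "bil y y \<le> 0" "r < n"
  shows "app y r = 0"
proof (rule ccontr)
  assume r: "app y r \<noteq> 0"
  have "2 \<le> neg"
  proof (rule neg_inertia_ge[where f = "\<lambda>j. if j = 0 then x else y"])
    fix a :: "nat \<Rightarrow> real"
    assume a: "\<exists>j<2. a j \<noteq> 0"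
    define z where "z i = a 0 * x i + a 1 * y i" for i
    have z: "(\<Sum>j<2. a j * (if j = 0 then x else y) i) = z i" for i
      by (simp add: z_def numeral_2_eq_2)
    have bz: "bil z v = a 0 * bil x v + a 1 * bil y v" for v
      unfolding z_def by (simp add: bil_linear)
    have zz: "bil z z = (a 0)\<^sup>2 * bil x x + (a 1)\<^sup>2 * bil y y"
      using assms(3) bil_commute[of _ z] bil_commute[of y x] by (simp add: bz power2_eq_square)
    have "bil z z \<le> 0"
      unfolding zz using assms(2,4) by (intro add_nonpos_nonpos) (auto simp: mult_le_0_iff)
    moreover have "\<exists>r<n. app z r \<noteq> 0"
    proof (cases "a 0 = 0")
      case True
      then have "a 1 \<noteq> 0" using a by (auto simp: numeral_2_eq_2 less_Suc_eq)
      moreover have "app z r = a 1 * app y r"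
        unfolding z_def by (simp add: True app_linear)
      ultimately show ?thesis using r assms(5) by auto
    next
      case False
      then have "bil z z < 0"
        unfolding zz using assms(2,4) by (intro add_neg_nonpos) (auto simp: mult_le_0_iff mult_less_0_iff)
      then show ?thesis using bil_eq_0[of z z] by force
    qed
    ultimately show "bil (\<lambda>i. \<Sum>j<2. a j * (if j = 0 then x else y) i)
        (\<lambda>i. \<Sum>j<2. a j * (if j = 0 then x else y) i) \<le> 0 \<and>
      (\<exists>r<n. app (\<lambda>i. \<Sum>j<2. a j * (if j = 0 then x else y) i) r \<noteq> 0)"
      unfolding z by simp
  qed
  with assms(1) show False by simp
qed

end

section \<open>Isotropic families with a triangular pairing\<close>

locale isotropic_triangular = symmetric_form +
  fixes u w :: "nat \<Rightarrow> nat" and k :: nat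
  assumes u: "i < k \<Longrightarrow> u i < n" and w: "i < k \<Longrightarrow> w i < n"
    and uu: "i < k \<Longrightarrow> j < k \<Longrightarrow> M (u i) (u j) = 0"
    and uw: "i < j \<Longrightarrow> j < k \<Longrightarrow> M (u i) (w j) = 0"
    and uw0: "i < k \<Longrightarrow> M (u i) (w i) \<noteq> 0"
begin

definition comb :: "(nat \<Rightarrow> real) \<Rightarrow> nat \<Rightarrow> real" where
  "comb a i = (\<Sum>j<k. a j * ev (u j) i)"

lemma app_comb: "app (comb a) r = (\<Sum>j<k. a j * M r (u j))"
proof -
  have "app (comb a) r = (\<Sum>j<k. a j * app (ev (u j)) r)"
    unfolding comb_def by (simp add: app_linear)
  then show ?thesis using u by (simp add: app_ev)
qed

lemma bil_comb: "bil (comb a) y = (\<Sum>j<k. a j * app y (u j))"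
proof -
  have "bil (comb a) y = (\<Sum>j<k. a j * bil (ev (u j)) y)"
    unfolding comb_def by (simp add: bil_linear)
  then show ?thesis using u by (simp add: bil_ev)
qed

lemma bil_comb_comb: "bil (comb a) (comb b) = 0"
  unfolding bil_comb using uu by (simp add: app_comb)

text \<open>Take the largest index \<open>p\<close> with a nonzero coefficient. Row
  \<open>w p\<close> annihilates the earlier \<open>u j\<close> by triangularity and the later
  coefficients vanish, so only the diagonal entry of the pairing survives.\<close>

lemma comb_not_radical:
  assumes "\<exists>j<k. a j \<noteq> 0"
  shows "\<exists>r<n. app (comb a) r \<noteq> 0"
proof -
  define J where "J = {j. j < k \<and> a j \<noteq> 0}"
  have J: "finite J" "J \<noteq> {}" using assms by (auto simp: J_def)
  define p where "p = Max J"
  have p: "p < k" "a p \<noteq> 0" using Max_in[OF J] by (auto simp: p_def J_def)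
  have a0: "a j = 0" if "p < j" "j < k" for j
    using Max_ge[OF J(1), of j] that unfolding p_def by (fastforce simp: J_def)
  have M0: "M (w p) (u j) = 0" if "j < p" for j
    using uw[OF that] sym[of "w p" "u j"] u[of j] w[of p] p that by simp
  have "app (comb a) (w p) = (\<Sum>j<k. if j = p then a p * M (w p) (u p) else 0)"
    unfolding app_comb
    by (intro sum.cong refl) (auto simp: linorder_neq_iff a0 M0)
  also have "\<dots> = a p * M (u p) (w p)" using p sym[of "w p" "u p"] u w by simp
  finally show ?thesis using p uw0 w by (intro exI[of _ "w p"]) auto
qed

lemma neg_inertia_ge_triangular: "k \<le> neg"
proof (rule neg_inertia_ge[where f = "\<lambda>j. ev (u j)"])
  fix a :: "nat \<Rightarrow> real" assume "\<exists>j<k. a j \<noteq> 0"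
  then show "bil (\<lambda>i. \<Sum>j<k. a j * ev (u j) i) (\<lambda>i. \<Sum>j<k. a j * ev (u j) i) \<le> 0 \<and>
    (\<exists>r<n. app (\<lambda>i. \<Sum>j<k. a j * ev (u j) i) r \<noteq> 0)"
    using comb_not_radical bil_comb_comb[of a a] unfolding comb_def[abs_def] by simp
qed

text \<open>Adding \<open>a k\<close> times \<open>z\<close> to a combination of the isotropic
  vectors gives a vector whose form is the square of \<open>a k\<close> times that of
  \<open>z\<close>, so \<open>z\<close> extends the family by one.\<close>

lemma neg_inertia_gt_triangular:
  assumes z: "\<And>i. i < k \<Longrightarrow> app z (u i) = 0" "bil z z < 0"
  shows "k < neg"
proof -
  have "Suc k \<le> neg"
  proof (rule neg_inertia_ge[where f = "\<lambda>j. if j < k then ev (u j) else z"])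
    fix a :: "nat \<Rightarrow> real" assume a: "\<exists>j<Suc k. a j \<noteq> 0"
    define y where "y i = comb a i + a k * z i" for i
    have y: "(\<Sum>j<Suc k. a j * (if j < k then ev (u j) else z) i) = y i" for i
      by (simp add: y_def comb_def)
    have lin: "bil y v = bil (comb a) v + a k * bil z v" for v
      unfolding y_def by (simp add: bil_linear)
    have "bil (comb a) z = 0" using z(1) by (simp add: bil_comb)
    then have yy: "bil y y = (a k)\<^sup>2 * bil z z"
      using bil_commute[of _ y] bil_commute[of z "comb a"] bil_comb_comb[of a a]
      by (simp add: lin power2_eq_square)
    have "bil y y \<le> 0" unfolding yy using z(2) by (simp add: mult_le_0_iff)
    moreover have "\<exists>r<n. app y r \<noteq> 0"
    proof (cases "a k = 0")
      case True
      then have "\<exists>j<k. a j \<noteq> 0" using a by (auto simp: less_Suc_eq)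
      moreover have "y = comb a" by (rule ext) (simp add: y_def True)
      ultimately show ?thesis using comb_not_radical by simp
    next
      case False
      then have "bil y y < 0" unfolding yy using z(2) by (simp add: mult_less_0_iff)
      then show ?thesis using bil_eq_0[of y y] by force
    qed
    ultimately show "bil (\<lambda>i. \<Sum>j<Suc k. a j * (if j < k then ev (u j) else z) i)
        (\<lambda>i. \<Sum>j<Suc k. a j * (if j < k then ev (u j) else z) i) \<le> 0 \<and>
      (\<exists>r<n. app (\<lambda>i. \<Sum>j<Suc k. a j * (if j < k then ev (u j) else z) i) r \<noteq> 0)"
      unfolding y by simp
  qed
  then show ?thesis by simp
qed

text \<open>Orthogonality to the isotropic vectors amounts to \<open>k\<close> linear conditions.
  With the two preceding bounds, the sign of the form on the orthogonal complement decides whether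
  \<open>neg\<close> equals \<open>k\<close>.\<close>

lemma neg_inertia_le_triangular:
  assumes "\<And>z. (\<And>i. i < k \<Longrightarrow> app z (u i) = 0) \<Longrightarrow> 0 \<le> bil z z"
  shows "neg \<le> k"
  by (rule neg_inertia_le[where L = "\<lambda>j. M (u j)"]) (use assms in \<open>auto simp: app_def\<close>)

end

section \<open>Signed graphs with one negative eigenvalue\<close>

locale signed_graph_form =
  fixes n :: nat and S :: "nat \<Rightarrow> nat \<Rightarrow> int"
  assumes sg: "signed_graph n S"

sublocale signed_graph_form \<subseteq> symmetric_form n "\<lambda>i j. real_of_int (S i j)"
  using sg by unfold_locales (simp add: signed_graph_def)

context signed_graph_form
begin

lemma neg_adj_matrix: "neg = neg_inertia (adj_matrix n S)"
  by (simp add: adj_matrix_def)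

lemma S_sym: "S u v = S v u"
  using sg by (simp add: signed_graph_def)

lemma S_diag: "S u u = 0"
  using sg by (simp add: signed_graph_def)

lemma S_cases: "S u v = -1 \<or> S u v = 0 \<or> S u v = 1"
  using sg unfolding signed_graph_def by auto

lemma S_square: "S u v \<noteq> 0 \<Longrightarrow> S u v * S u v = 1"
  using S_cases[of u v] by auto

lemma adj_sym: "adj n S u v \<longleftrightarrow> adj n S v u"
  using S_sym[of u v] by (auto simp: adj_def)

text \<open>The form has value -2 here, whatever the sign of the edge. This is the negative vector
  in every use of \<open>radical_of_neg_inertia_le_1\<close> below.\<close>

lemma edge_vector:
  assumes "u < n" "v < n" "S u v \<noteq> 0"
  defines "x \<equiv> \<lambda>i. ev u i - real_of_int (S u v) * ev v i"
  shows "bil x y = app y u - real_of_int (S u v) * app y v" "bil x x < 0"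
proof -
  show *: "bil x y = app y u - real_of_int (S u v) * app y v" for y
    unfolding x_def using assms by (simp add: bil_linear bil_ev)
  have "app x r = real_of_int (S r u) - real_of_int (S u v) * real_of_int (S r v)" for r
    unfolding x_def using assms by (simp add: app_linear app_ev)
  then show "bil x x < 0"
    using assms(3) S_cases[of u v] S_sym[of u v] by (auto simp: * S_diag)
qed

text \<open>The unit vector at \<open>w\<close> is isotropic and orthogonal to the edge vector of
  \<open>u\<close> and \<open>v\<close>, hence in the radical. In a connected graph this makes
  non-adjacency transitive.\<close>

lemma nonadjacent_to_edge_isolated:
  assumes neg: "neg \<le> 1" and "u < n" "v < n" "S u v \<noteq> 0" "w < n" "S w u = 0" "S w v = 0" "r < n"
  shows "S w r = 0"
proof -
  have "app (ev w) r = 0"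
    by (rule radical_of_neg_inertia_le_1[OF neg edge_vector(2)[of u v]])
      (use assms S_sym[of w u] S_sym[of w v] in \<open>auto simp: edge_vector app_ev bil_ev S_diag\<close>)
  then show ?thesis using assms S_sym[of w r] by (simp add: app_ev)
qed

lemma nonadjacent_rows:
  assumes neg: "neg \<le> 1" and "u < n" "w < n" "y < n" "S w y = 0" "S u w \<noteq> 0" "S u y \<noteq> 0" "r < n"
  shows "S w r = S u w * S u y * S y r"
proof -
  \<comment> \<open>The coefficient is chosen so that \<open>app z u = 0\<close>. As
    \<open>w\<close> and \<open>y\<close> are non-adjacent, \<open>app z y = 0\<close> holds as well
    and \<open>z\<close> is isotropic.\<close>
  define z where "z i = ev w i - real_of_int (S u w * S u y) * ev y i" for i
  have z: "app z r = real_of_int (S r w) - real_of_int (S u w * S u y) * real_of_int (S r y)" for r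
    unfolding z_def using assms by (simp add: app_linear app_ev)
  have "bil z z = app z w - real_of_int (S u w * S u y) * app z y"
    by (subst z_def[abs_def]) (use assms in \<open>simp add: bil_linear bil_ev\<close>)
  also have "\<dots> = 0" using assms S_sym[of y w] by (simp add: z S_diag)
  finally have "bil z z = 0" .
  have "app z r = 0"
    by (rule radical_of_neg_inertia_le_1[OF neg edge_vector(2)[of u y]])
      (use assms S_sym[of y w] S_cases[of u w] S_cases[of u y] \<open>bil z z = 0\<close> in \<open>auto simp: edge_vector z S_diag\<close>)
  then have "real_of_int (S r w) = real_of_int (S u w * S u y * S r y)" by (simp add: z)
  then show ?thesis unfolding of_int_eq_iff using S_sym[of r w] S_sym[of r y] by simp
qed

lemma triangle_negative:
  assumes neg: "neg \<le> 1" and uvw: "u < n" "v < n" "w < n" and e: "S u v \<noteq> 0" "S v w \<noteq> 0" "S w u \<noteq> 0"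
  shows "S u v * S v w * S w u = -1"
proof (rule ccontr)
  assume "S u v * S v w * S w u \<noteq> -1"
  then have pos: "S u v * S v w * S w u = 1"
    using e S_cases[of u v] S_cases[of v w] S_cases[of w u] by auto
  \<comment> \<open>The coefficients make \<open>app z\<close> vanish at \<open>u\<close> and
    \<open>v\<close>, so \<open>z\<close> is orthogonal to the edge vector. At \<open>w\<close> the
    value is -2 times the sign of the triangle, so a positive triangle yields a second negative
    direction.\<close>
  define z where "z i = ev w i - real_of_int (S u v * S v w) * ev u i - real_of_int (S u v * S w u) * ev v i" for i
  have z: "app z r = real_of_int (S r w) - real_of_int (S u v * S v w) * real_of_int (S r u)
      - real_of_int (S u v * S w u) * real_of_int (S r v)" for r
    unfolding z_def using uvw by (simp add: app_linear app_ev)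
  have zz: "app z u = 0" "app z v = 0" "app z w = -2"
    using e pos S_cases[of u v] S_cases[of v w] S_cases[of w u] S_sym[of u w] S_sym[of v u] S_sym[of w v]
    by (auto simp: z S_diag)
  have "bil z z = app z w - real_of_int (S u v * S v w) * app z u - real_of_int (S u v * S w u) * app z v"
    by (subst z_def[abs_def]) (use uvw in \<open>simp add: bil_linear bil_ev\<close>)
  then have "bil z z \<le> 0" using zz by simp
  then have "app z w = 0"
    by (intro radical_of_neg_inertia_le_1[OF neg edge_vector(2)[of u v]])
      (use uvw e zz in \<open>auto simp: edge_vector\<close>)
  with zz show False by simp
qed

section \<open>Multipartite graphs with at most one negative eigenvalue\<close>

lemma neg_inertia_le_1_multipartite:
  fixes \<theta> :: "nat \<Rightarrow> real" and p :: "nat \<Rightarrow> nat"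
  assumes S: "\<And>u v. u < n \<Longrightarrow> v < n \<Longrightarrow> real_of_int (S u v) = (if p u = p v then 0 else - (\<theta> u * \<theta> v))"
    and p: "\<And>u. u < n \<Longrightarrow> p u < l"
  shows "neg \<le> 1"
proof (rule neg_inertia_le[where L = "\<lambda>_. \<theta>"])
  fix x :: "nat \<Rightarrow> real"
  assume "\<forall>j<1::nat. (\<Sum>i<n. \<theta> i * x i) = 0"
  then have 0: "(\<Sum>i<n. \<theta> i * x i) = 0" by simp
  define y where "y i = \<theta> i * x i" for i
  define P where "P k i = (if p i = k then y i else 0)" for k i
  \<comment> \<open>With y = \<theta>x the form is the sum over the parts of the squared part sums
    of y, minus the square of the total sum. The functional \<open>\<theta>\<close> is this total,
    so only the squares of the parts remain on its kernel.\<close>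
  have "bil x x = (\<Sum>i<n. \<Sum>j<n. (\<Sum>k<l. P k i * P k j) - y i * y j)"
    unfolding bil_def app_def sum_distrib_left
  proof (intro sum.cong refl)
    fix i j assume ij: "i \<in> {..<n}" "j \<in> {..<n}"
    have "(\<Sum>k<l. P k i * P k j) = (\<Sum>k<l. if k = p i then (if p i = p j then y i * y j else 0) else 0)"
      by (intro sum.cong) (auto simp: P_def)
    also have "\<dots> = (if p i = p j then y i * y j else 0)" using p ij by simp
    finally show "x i * (real_of_int (S i j) * x j) = (\<Sum>k<l. P k i * P k j) - y i * y j"
      using S[of i j] ij by (simp add: y_def mult_ac)
  qed
  also have "\<dots> = (\<Sum>i<n. \<Sum>j<n. \<Sum>k<l. P k i * P k j) - (\<Sum>i<n. y i) * (\<Sum>j<n. y j)"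
    by (simp add: sum_subtractf sum_product)
  also have "(\<Sum>i<n. y i) = 0" using 0 by (simp add: y_def)
  also have "(\<Sum>i<n. \<Sum>j<n. \<Sum>k<l. P k i * P k j) = (\<Sum>i<n. \<Sum>k<l. \<Sum>j<n. P k i * P k j)"
    by (intro sum.cong refl sum.swap)
  also have "\<dots> = (\<Sum>k<l. \<Sum>i<n. \<Sum>j<n. P k i * P k j)"
    by (rule sum.swap)
  also have "\<dots> = (\<Sum>k<l. (\<Sum>i<n. P k i)\<^sup>2)"
    by (simp add: power2_eq_square sum_product)
  finally show "0 \<le> bil x x" by (simp add: sum_nonneg)
qed

lemma neg_inertia_positive_bipartite:
  assumes sw: "switching_equiv n S T" and T: "pos_complete_bipartite n T"
  shows "neg \<le> 1"
proof -
  obtain \<theta> where \<theta>: "\<And>u. u < n \<Longrightarrow> \<theta> u \<in> {-1, 1::int}"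
      "\<And>u v. u < n \<Longrightarrow> v < n \<Longrightarrow> T u v = \<theta> u * S u v * \<theta> v"
    using sw unfolding switching_equiv_def by blast
  obtain p where p: "\<And>u. u < n \<Longrightarrow> p u < (2::nat)"
      "\<And>u v. u < n \<Longrightarrow> v < n \<Longrightarrow> adj n T u v \<longleftrightarrow> p u \<noteq> p v"
    using T unfolding pos_complete_bipartite_def complete_multipartite_def by blast
  have T1: "T u v = 1" if "u < n" "v < n" "p u \<noteq> p v" for u v
    using T that p(2)[of u v] unfolding pos_complete_bipartite_def by blast
  have T0: "T u v = 0" if "u < n" "v < n" "p u = p v" for u v
    using that p(2)[of u v] by (simp add: adj_def)
  show ?thesis
  proof (rule neg_inertia_le_1_multipartite)
    fix u v assume uv: "u < n" "v < n"
    have "S u v = \<theta> u * T u v * \<theta> v" using \<theta>(1)[OF uv(1)] \<theta>(1)[OF uv(2)] \<theta>(2)[OF uv] by auto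
    \<comment> \<open>Negating the switching function on one of the two sides turns the positive
      edges between them into the shape -\<theta>(u)\<theta>(v).\<close>
    then show "real_of_int (S u v) = (if p u = p v then 0 else
        - (real_of_int (if p u = 0 then \<theta> u else - \<theta> u) * real_of_int (if p v = 0 then \<theta> v else - \<theta> v)))"
      using p(1)[OF uv(1)] p(1)[OF uv(2)] T1[OF uv] T0[OF uv] by (auto simp: less_2_cases_iff)
  qed (rule p)
qed

lemma is_cycle_triangle:
  "is_cycle n S [x, y, z] \<longleftrightarrow> distinct [x, y, z] \<and> adj n S x y \<and> adj n S y z \<and> adj n S z x"
  unfolding is_cycle_def by (auto simp: All_less_Suc)

lemma cycle_sign_triangle: "cycle_sign S [x, y, z] = S x y * S y z * S z x"
  unfolding cycle_sign_def by (simp add: lessThan_Suc mult_ac)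

lemma neg_inertia_negative_multipartite:
  assumes l: "3 \<le> l" "complete_multipartite n S l"
    and tri: "\<And>t. is_cycle n S t \<Longrightarrow> length t = 3 \<Longrightarrow> cycle_sign S t = -1"
  shows "neg \<le> 1"
proof -
  obtain p where p: "\<And>u. u < n \<Longrightarrow> p u < l" "\<And>k. k < l \<Longrightarrow> \<exists>u<n. p u = k"
      "\<And>u v. u < n \<Longrightarrow> v < n \<Longrightarrow> adj n S u v \<longleftrightarrow> p u \<noteq> p v"
    using l(2) unfolding complete_multipartite_def by blast
  have S0: "S u v = 0 \<longleftrightarrow> p u = p v" if "u < n" "v < n" for u v
    using p(3)[OF that] that by (simp add: adj_def)
  have tri': "S x y * S y z * S z x = -1"
    if "x < n" "y < n" "z < n" "p x \<noteq> p y" "p y \<noteq> p z" "p z \<noteq> p x" for x y z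
    using tri[of "[x, y, z]"] that p(3) unfolding is_cycle_triangle cycle_sign_triangle by auto
  have third: "S x y = - (S x z * S y z)"
    if "x < n" "y < n" "z < n" "p x \<noteq> p y" "p y \<noteq> p z" "p z \<noteq> p x" for x y z
    using tri'[OF that] S_cases[of x y] S_cases[of y z] S_cases[of x z] S_sym[of z x] by auto
  obtain a b d where abd: "a < n" "p a = 0" "b < n" "p b = 1" "d < n" "p d = 2"
    using p(2)[of 0] p(2)[of 1] p(2)[of 2] l(1) by force
  \<comment> \<open>The vertex \<open>a\<close> is the reference: outside its part, triangles
    through \<open>a\<close> dictate the value \<open>- S a u\<close>. Vertices in the part of
    \<open>a\<close> are not joined to it and are compared with it at the common neighbour
    \<open>b\<close>.\<close>
  define \<theta> where "\<theta> u = (if p u = 0 then S u b * S a b else - S a u)" for u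
  have cross: "S u v = S u b * S a b * S a v" if uv: "u < n" "v < n" "p u = 0" "p v \<noteq> 0" for u v
  proof -
    \<comment> \<open>The triangles u, x, y and a, x, y share the edge x y, so the relative sign of
      \<open>u\<close> against \<open>a\<close> is the same at \<open>x\<close> and at
      \<open>y\<close>. If \<open>v\<close> lies in the part of \<open>b\<close>, the comparison
      passes through \<open>d\<close>; this is where a third part enters.\<close>
    have ex: "S u x * S a x = S u y * S a y" if "x < n" "y < n" "p x \<noteq> 0" "p y \<noteq> 0" "p x \<noteq> p y" for x y
      using that uv abd third[of u x y] third[of a x y] S0[of u x] S0[of a x] S0[of u y] S0[of a y] S0[of x y]
        S_cases[of u x] S_cases[of a x] S_cases[of u y] S_cases[of a y] S_cases[of x y] by auto
    have "S u v * S a v = S u b * S a b"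
    proof (cases "p v = 1")
      case True
      then show ?thesis using ex[of v d] ex[of b d] uv abd by simp
    next
      case False
      then show ?thesis using ex[of v b] uv abd by simp
    qed
    then show ?thesis using S0[of a v] S_square[of a v] uv abd
      by (metis mult.assoc mult.right_neutral)
  qed
  have S\<theta>: "S u v = - (\<theta> u * \<theta> v)" if uv: "u < n" "v < n" "p u \<noteq> p v" for u v
  proof -
    consider "p u = 0" "p v \<noteq> 0" | "p u \<noteq> 0" "p v = 0" | "p u \<noteq> 0" "p v \<noteq> 0" using uv by auto
    then show ?thesis
    proof cases
      case 1
      then show ?thesis using cross[of u v] uv by (simp add: \<theta>_def)
    next
      case 2
      then show ?thesis using cross[of v u] uv S_sym[of u v] by (simp add: \<theta>_def)
    next
      case 3
      then show ?thesis using third[of u v a] uv abd S_sym[of a u] S_sym[of a v] by (simp add: \<theta>_def)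
    qed
  qed
  show ?thesis
  proof (rule neg_inertia_le_1_multipartite)
    fix u v assume uv: "u < n" "v < n"
    show "real_of_int (S u v) = (if p u = p v then 0 else - (real_of_int (\<theta> u) * real_of_int (\<theta> v)))"
      using S0[OF uv] S\<theta>[OF uv] by simp
  qed (rule p)
qed

section \<open>Structure of connected graphs with at most one negative eigenvalue\<close>

lemma connected_neighbour:
  assumes "connected_sg n S" "u < n" "v < n" "u \<noteq> v"
  obtains r where "r < n" "S u r \<noteq> 0"
proof -
  have "(adj n S)\<^sup>*\<^sup>* u v" using assms by (simp add: connected_sg_def)
  then show thesis using assms(4) that by (cases rule: converse_rtranclpE) (auto simp: adj_def)
qed

lemma neg_inertia_le_1_structure:
  assumes con: "connected_sg n S" and neg: "neg \<le> 1" and ab: "adj n S a b"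
  shows "(\<exists>T. signed_graph n T \<and> switching_equiv n S T \<and> pos_complete_bipartite n T)
         \<or> (\<exists>l\<ge>3. complete_multipartite n S l \<and>
              (\<forall>t. is_cycle n S t \<and> length t = 3 \<longrightarrow> cycle_sign S t = -1))"
proof -
  have a: "a < n" "b < n" "S a b \<noteq> 0" using ab by (auto simp: adj_def)
  then have "a \<noteq> b" using S_diag by auto
  define R where "R = {(u, v). u < n \<and> v < n \<and> S u v = 0}"
  \<comment> \<open>If \<open>u\<close> and \<open>w\<close> were adjacent, \<open>v\<close> would
    be non-adjacent to both ends of an edge and hence isolated, against connectedness.\<close>
  have trans: "S u w = 0" if "u < n" "v < n" "w < n" "S u v = 0" "S v w = 0" for u v w
  proof (rule ccontr)
    assume "S u w \<noteq> 0"
    then have "S v r = 0" if "r < n" for r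
      using nonadjacent_to_edge_isolated[OF neg, of u w v r] S_sym[of v u] that
        \<open>u < n\<close> \<open>v < n\<close> \<open>w < n\<close> \<open>S u v = 0\<close> \<open>S v w = 0\<close> by simp
    moreover obtain x where x: "x < n" "v \<noteq> x" using a \<open>a \<noteq> b\<close> by (cases "v = a") auto
    obtain r where "r < n" "S v r \<noteq> 0" by (rule connected_neighbour[OF con \<open>v < n\<close> x])
    ultimately show False by simp
  qed
  have R: "equiv {..<n} R"
  proof (rule equivI)
    show "R \<subseteq> {..<n} \<times> {..<n}" by (auto simp: R_def)
    show "refl_on {..<n} R" by (rule refl_onI) (auto simp: R_def S_diag)
    show "sym R"
    proof (rule symI)
      fix u v assume "(u, v) \<in> R"
      then show "(v, u) \<in> R" using S_sym[of u v] by (simp add: R_def)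
    qed
    show "trans R"
    proof (rule transI)
      fix u v w assume "(u, v) \<in> R" "(v, w) \<in> R"
      then show "(u, w) \<in> R" using trans[of u v w] by (simp add: R_def)
    qed
  qed
  define l where "l = card ({..<n} // R)"
  have "finite ({..<n} // R)" by (rule finite_quotient) (auto simp: R_def)
  \<comment> \<open>The parts are the classes of non-adjacency; \<open>h\<close> numbers them
    consecutively, as \<open>complete_multipartite\<close> demands.\<close>
  then obtain h where h: "bij_betw h ({..<n} // R) {0..<l}"
    using ex_bij_betw_finite_nat unfolding l_def by blast
  define p where "p u = h (R `` {u})" for u
  have cls: "R `` {u} \<in> {..<n} // R" if "u < n" for u using that by (auto intro: quotientI)
  have pR: "p u = p v \<longleftrightarrow> S u v = 0" if "u < n" "v < n" for u v
  proof -
    have "p u = p v \<longleftrightarrow> R `` {u} = R `` {v}"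
      unfolding p_def using h cls that by (metis bij_betw_def inj_on_eq_iff)
    also have "\<dots> \<longleftrightarrow> (u, v) \<in> R" using eq_equiv_class_iff[OF R] that by simp
    finally show ?thesis using that by (simp add: R_def)
  qed
  have pl: "p u < l" if "u < n" for u
    using bij_betwE[OF h] cls[OF that] by (auto simp: p_def)
  have ps: "\<exists>u<n. p u = k" if "k < l" for k
  proof -
    have "k \<in> h ` ({..<n} // R)" using h that by (simp add: bij_betw_def)
    then show ?thesis unfolding p_def by (auto elim!: quotientE)
  qed
  have cm: "complete_multipartite n S l"
    unfolding complete_multipartite_def using pl ps pR by (intro exI[of _ p]) (auto simp: adj_def)
  show ?thesis
  proof (cases "3 \<le> l")
    case True
    have "cycle_sign S t = -1" if t: "is_cycle n S t" "length t = 3" for t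
    proof -
      obtain x y z where "t = [x, y, z]" using t(2) by (auto simp: numeral_3_eq_3 length_Suc_conv)
      then show ?thesis
        using t(1) triangle_negative[OF neg, of x y z]
        by (simp add: is_cycle_triangle cycle_sign_triangle adj_def)
    qed
    with True cm show ?thesis by blast
  next
    case False
    have "p a \<noteq> p b" using pR a by simp
    then have l2: "l = 2" using False pl[of a] pl[of b] a by auto
    \<comment> \<open>This switching makes all edges at \<open>a\<close> and at \<open>b\<close>
      positive; \<open>nonadjacent_rows\<close> then forces the other edges to be positive too. The
      first branch is the side of \<open>a\<close>, the second the side of \<open>b\<close>.\<close>
    define \<theta> where "\<theta> x = (if S x b \<noteq> 0 then S x b * S a b else S a x)" for x
    have side: "p x = p a \<and> S x b \<noteq> 0 \<or> p x = p b \<and> S x b = 0 \<and> S a x \<noteq> 0" if "x < n" for x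
      using pl[OF that] pl[of a] pl[of b] a \<open>p a \<noteq> p b\<close> l2 pR[of x b] pR[of a x] that by auto
    have \<theta>1: "\<theta> x \<in> {-1, 1}" if "x < n" for x
      using side[OF that] a(3) S_cases[of x b] S_cases[of a b] S_cases[of a x] by (auto simp: \<theta>_def)
    have \<theta>2: "S u v = \<theta> u * \<theta> v" if uv: "u < n" "v < n" and pp: "p u = p a" "p v = p b" for u v
    proof -
      have "S u v = S b u * S b a * S a v"
        by (rule nonadjacent_rows[OF neg]) (use uv pp a pR[of b u] pR[of u a] S_sym[of a b] \<open>p a \<noteq> p b\<close> in auto)
      moreover have "S u b \<noteq> 0" "S v b = 0" using pR[of u b] pR[of v b] uv pp a \<open>p a \<noteq> p b\<close> by auto
      ultimately show ?thesis using S_sym[of b u] S_sym[of b a] by (simp add: \<theta>_def)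
    qed
    define T where "T u v = (if u < n \<and> v < n then \<theta> u * S u v * \<theta> v else 0)" for u v
    have T1: "T u v = (if p u = p v then 0 else 1)" if uv: "u < n" "v < n" for u v
    proof (cases "p u = p v")
      case True
      then show ?thesis using uv pR[OF uv] by (simp add: T_def)
    next
      case False
      then have "S u v = \<theta> u * \<theta> v"
        using side[OF uv(1)] side[OF uv(2)] \<theta>2[of u v] \<theta>2[of v u] uv S_sym[of u v] by (auto simp: mult.commute)
      then show ?thesis using False \<theta>1[OF uv(1)] \<theta>1[OF uv(2)] uv by (auto simp: T_def)
    qed
    have "signed_graph n T"
      unfolding signed_graph_def
    proof (intro conjI allI)
      fix u v
      show "T u v \<in> {-1, 0, 1}" using T1[of u v] by (cases "u < n \<and> v < n") (auto simp: T_def)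
      show "T u v = T v u" using S_sym[of u v] by (simp add: T_def)
      show "T u u = 0" by (simp add: T_def S_diag)
    qed
    moreover have "switching_equiv n S T"
      unfolding switching_equiv_def using \<theta>1 by (intro exI[of _ \<theta>]) (auto simp: T_def)
    moreover have "pos_complete_bipartite n T"
      unfolding pos_complete_bipartite_def complete_multipartite_def
      using pl ps T1 l2 by (intro conjI exI[of _ p]) (auto simp: adj_def)
    ultimately show ?thesis by blast
  qed
qed

end

section \<open>Shortest cycles\<close>

text \<open>Splitting off the closing edge removes the \<open>mod\<close>, so that cycles assembled
  from list segments can be checked edge by edge.\<close>

lemma is_cycle_iff:
  "is_cycle n S c \<longleftrightarrow> 3 \<le> length c \<and> distinct c \<and>
    (\<forall>i. Suc i < length c \<longrightarrow> adj n S (c ! i) (c ! Suc i)) \<and> adj n S (c ! (length c - 1)) (c ! 0)"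
proof (cases "length c")
  case (Suc h)
  have "(\<forall>i<Suc h. adj n S (c ! i) (c ! ((i + 1) mod Suc h))) \<longleftrightarrow>
      (\<forall>i<h. adj n S (c ! i) (c ! Suc i)) \<and> adj n S (c ! h) (c ! 0)"
    by (simp add: All_less_Suc conj_commute)
  then show ?thesis unfolding is_cycle_def Suc by simp
qed (simp add: is_cycle_def)

lemma girth_le: "is_cycle n S c \<Longrightarrow> girth n S \<le> length c"
  unfolding girth_def by (rule Least_le) auto

text \<open>Lets any vertex of a shortest cycle be moved to position 0, where
  \<open>neg_inertia_pendant\<close> expects the attachment.\<close>

lemma is_cycle_rotate:
  assumes "is_cycle n S c"
  shows "is_cycle n S (rotate r c)"
proof -
  let ?l = "length c"
  have "adj n S (rotate r c ! i) (rotate r c ! ((i + 1) mod ?l))" if "i < ?l" for i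
  proof -
    have "(i + 1) mod ?l < ?l" using that by (intro mod_less_divisor) auto
    then have "rotate r c ! ((i + 1) mod ?l) = c ! ((r + (i + 1) mod ?l) mod ?l)" by (rule nth_rotate)
    also have "(r + (i + 1) mod ?l) mod ?l = ((r + i) mod ?l + 1) mod ?l" by (simp add: mod_simps)
    finally have "rotate r c ! ((i + 1) mod ?l) = c ! (((r + i) mod ?l + 1) mod ?l)" .
    moreover have "(r + i) mod ?l < ?l" using that by (intro mod_less_divisor) auto
    ultimately show ?thesis using assms that by (simp add: is_cycle_def nth_rotate)
  qed
  then show ?thesis using assms by (simp add: is_cycle_def)
qed

locale shortest_cycle = signed_graph_form +
  fixes c :: "nat list"
  assumes cyc: "is_cycle n S c" and shortest: "\<And>d. is_cycle n S d \<Longrightarrow> length c \<le> length d"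
begin

abbreviation g :: nat where "g \<equiv> length c"

lemma g3: "3 \<le> g"
  using cyc by (simp add: is_cycle_def)

lemma c_nonempty: "c \<noteq> []"
  using g3 by auto

lemma c_distinct: "distinct c"
  using cyc by (simp add: is_cycle_def)

lemma c_step: "Suc i < g \<Longrightarrow> adj n S (c ! i) (c ! Suc i)"
  using cyc by (simp add: is_cycle_iff)

lemma c_close: "adj n S (c ! (g - 1)) (c ! 0)"
  using cyc by (simp add: is_cycle_iff)

lemma c_less: "i < g \<Longrightarrow> c ! i < n"
  using cyc by (simp add: is_cycle_def adj_def)

text \<open>A chord closes the segment from \<open>i\<close> to \<open>j\<close> into a cycle of
  length j - i + 1, which is shorter than g unless the positions are 0 and g - 1.\<close>

lemma chordless:
  assumes ij: "i < j" "j < g" and e: "S (c ! i) (c ! j) \<noteq> 0"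
  shows "j = Suc i \<or> i = 0 \<and> j = g - 1"
proof (rule ccontr)
  assume no: "\<not> ?thesis"
  define d where "d = take (j - i + 1) (drop i c)"
  have ld: "length d = j - i + 1" using ij by (simp add: d_def)
  have d: "d ! k = c ! (i + k)" if "k \<le> j - i" for k using that ij by (simp add: d_def)
  have "is_cycle n S d"
    unfolding is_cycle_iff
  proof (intro conjI allI impI)
    show "3 \<le> length d" using no ij ld by auto
    show "distinct d" using c_distinct by (simp add: d_def)
    fix k assume "Suc k < length d"
    then show "adj n S (d ! k) (d ! Suc k)" using ld d[of k] d[of "Suc k"] c_step[of "i + k"] ij by simp
  next
    show "adj n S (d ! (length d - 1)) (d ! 0)"
      using ld d[of 0] d[of "j - i"] ij e c_less[of i] c_less[of j] S_sym[of "c ! i" "c ! j"] by (simp add: adj_def)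
  qed
  from shortest[OF this] show False using ld no ij by auto
qed

text \<open>Starting at position 1 keeps clear of the closing edge, so the exceptional case of
  \<open>chordless\<close> never occurs. The vertex at 2j + 1 is also adjacent to the one at 2j,
  which is \<open>w (j - 1)\<close> for j > 0; hence the pairing is triangular and not
  diagonal.\<close>

lemma isotropic_cycle:
  "isotropic_triangular n (\<lambda>i j. real_of_int (S i j)) (\<lambda>j. c ! (2 * j + 1)) (\<lambda>j. c ! (2 * j + 2)) ((g - 1) div 2)"
proof unfold_locales
  fix i j :: nat
  show "c ! (2 * i + 1) < n" "c ! (2 * i + 2) < n" if "i < (g - 1) div 2"
    using that c_less by auto
  show "real_of_int (S (c ! (2 * i + 1)) (c ! (2 * i + 2))) \<noteq> 0" if "i < (g - 1) div 2"
    using that c_step[of "2 * i + 1"] by (auto simp: adj_def)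
  show "real_of_int (S (c ! (2 * i + 1)) (c ! (2 * j + 1))) = 0" if ij: "i < (g - 1) div 2" "j < (g - 1) div 2"
  proof -
    have *: "S (c ! (2 * i + 1)) (c ! (2 * j + 1)) = 0" if "i < j" "j < (g - 1) div 2" for i j
    proof (rule ccontr)
      assume "S (c ! (2 * i + 1)) (c ! (2 * j + 1)) \<noteq> 0"
      then have "2 * j + 1 = Suc (2 * i + 1) \<or> 2 * i + 1 = 0 \<and> 2 * j + 1 = g - 1"
        using that by (intro chordless) auto
      then show False using that by presburger
    qed
    consider "i < j" | "i = j" | "j < i" by linarith
    then show ?thesis
      using *[of i j] *[of j i] ij S_diag S_sym[of "c ! (2 * i + 1)" "c ! (2 * j + 1)"] by cases auto
  qed
  show "real_of_int (S (c ! (2 * i + 1)) (c ! (2 * j + 2))) = 0" if ij: "i < j" "j < (g - 1) div 2"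
  proof (rule ccontr)
    assume "\<not> ?thesis"
    then have "S (c ! (2 * i + 1)) (c ! (2 * j + 2)) \<noteq> 0" by simp
    then have "2 * j + 2 = Suc (2 * i + 1) \<or> 2 * i + 1 = 0 \<and> 2 * j + 2 = g - 1"
      using that by (intro chordless) auto
    then show False using that by presburger
  qed
qed

lemma neg_inertia_lower: "(g - 1) div 2 \<le> neg"
  by (rule isotropic_triangular.neg_inertia_ge_triangular[OF isotropic_cycle])

text \<open>A second neighbour at position \<open>j\<close> would close cycles of lengths j + 2 and
  g - j + 2 along the two arcs. Both can be at least g only if g \<le> 4.\<close>

lemma neighbour_outside_unique:
  assumes g5: "5 \<le> g" and v: "v \<notin> set c" "adj n S v (c ! 0)" and j: "0 < j" "j < g"
  shows "S v (c ! j) = 0"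
proof (rule ccontr)
  assume "S v (c ! j) \<noteq> 0"
  then have vj: "adj n S v (c ! j)" using v j c_less by (simp add: adj_def)
  define d where "d = v # take (Suc j) c"
  define d' where "d' = v # drop j c @ [c ! 0]"
  have "is_cycle n S d"
    unfolding is_cycle_iff
  proof (intro conjI allI impI)
    show "3 \<le> length d" using j by (simp add: d_def)
    show "distinct d" using c_distinct v by (auto simp: d_def dest: in_set_takeD)
    fix k assume k: "Suc k < length d"
    show "adj n S (d ! k) (d ! Suc k)"
      using k j v c_step[of "k - 1"] by (cases k) (auto simp: d_def)
  next
    show "adj n S (d ! (length d - 1)) (d ! 0)"
      using j vj adj_sym[of v] by (simp add: d_def min_absorb2)
  qed
  then have "g \<le> j + 2" using shortest[of d] j by (simp add: d_def)
  have "is_cycle n S d'"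
    unfolding is_cycle_iff
  proof (intro conjI allI impI)
    show "3 \<le> length d'" using j by (simp add: d'_def)
    have "c ! 0 \<notin> set (drop j c)"
      using nth_eq_iff_index_eq[OF c_distinct, of _ 0] j c_nonempty by (auto simp: in_set_conv_nth)
    moreover have "c ! 0 \<in> set c" using j by (intro nth_mem) auto
    ultimately show "distinct d'" using c_distinct v by (auto simp: d'_def dest: in_set_dropD)
    fix k assume k: "Suc k < length d'"
    show "adj n S (d' ! k) (d' ! Suc k)"
    proof (cases k)
      case 0
      then show ?thesis using vj j by (simp add: d'_def nth_append)
    next
      case (Suc q)
      show ?thesis
      proof (cases "Suc q < g - j")
        case True
        then show ?thesis using Suc j c_step[of "j + q"] by (simp add: d'_def nth_append)
      next
        case False
        then have "Suc q = g - j" "j + q = g - 1" "g - Suc j < g - j" using Suc k j by (auto simp: d'_def)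
        then show ?thesis using Suc j c_close by (simp add: d'_def nth_append)
      qed
    qed
  next
    show "adj n S (d' ! (length d' - 1)) (d' ! 0)"
      using v(2) adj_sym[of v] by (simp add: d'_def nth_append)
  qed
  then have "g \<le> (g - j) + 2" using shortest[of d'] j by (simp add: d'_def)
  with \<open>g \<le> j + 2\<close> j g5 show False by linarith
qed

text \<open>The pair \<open>v\<close>, \<open>c ! 0\<close> has to come first in the family:
  \<open>c ! 1\<close> is adjacent to \<open>c ! 0\<close>, which triangularity tolerates only if
  \<open>c ! 1\<close> has the larger index. The other zeros hold because \<open>v\<close> has no
  further neighbour on the cycle.\<close>

lemma neg_inertia_pendant:
  assumes g5: "5 \<le> g" and v: "v \<notin> set c" "adj n S v (c ! 0)"
  shows "(g - 1) div 2 < neg"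
proof -
  interpret iso: isotropic_triangular n "\<lambda>i j. real_of_int (S i j)" "\<lambda>j. c ! (2 * j + 1)" "\<lambda>j. c ! (2 * j + 2)" "(g - 1) div 2"
    by (rule isotropic_cycle)
  note nb = neighbour_outside_unique[OF g5 v]
  have "isotropic_triangular n (\<lambda>i j. real_of_int (S i j)) (case_nat v (\<lambda>j. c ! (2 * j + 1)))
      (case_nat (c ! 0) (\<lambda>j. c ! (2 * j + 2))) (Suc ((g - 1) div 2))"
  proof unfold_locales
    fix i j :: nat
    show "case_nat v (\<lambda>j. c ! (2 * j + 1)) i < n" if "i < Suc ((g - 1) div 2)"
      using that iso.u v by (cases i) (auto simp: adj_def)
    show "case_nat (c ! 0) (\<lambda>j. c ! (2 * j + 2)) i < n" if "i < Suc ((g - 1) div 2)"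
      using that iso.w v by (cases i) (auto simp: adj_def)
    show "real_of_int (S (case_nat v (\<lambda>j. c ! (2 * j + 1)) i) (case_nat v (\<lambda>j. c ! (2 * j + 1)) j)) = 0"
      if "i < Suc ((g - 1) div 2)" "j < Suc ((g - 1) div 2)"
      using that iso.uu nb[of "2 * (i - 1) + 1"] nb[of "2 * (j - 1) + 1"] S_sym[of v "c ! (2 * (i - 1) + 1)"]
      by (cases i; cases j) (auto simp: S_diag)
    show "real_of_int (S (case_nat v (\<lambda>j. c ! (2 * j + 1)) i) (case_nat (c ! 0) (\<lambda>j. c ! (2 * j + 2)) j)) = 0"
      if "i < j" "j < Suc ((g - 1) div 2)"
      using that iso.uw[of "i - 1" "j - 1"] nb[of "2 * (j - 1) + 2"] by (cases i; cases j) auto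
    show "real_of_int (S (case_nat v (\<lambda>j. c ! (2 * j + 1)) i) (case_nat (c ! 0) (\<lambda>j. c ! (2 * j + 2)) i)) \<noteq> 0"
      if "i < Suc ((g - 1) div 2)"
      using that iso.uw0[of "i - 1"] v by (cases i) (auto simp: adj_def)
  qed
  from isotropic_triangular.neg_inertia_ge_triangular[OF this] show ?thesis by simp
qed

text \<open>Chords being excluded, a graph other than the cycle has a vertex off it, and a walk from
  the cycle to that vertex leaves the cycle along some edge.\<close>

lemma exists_neighbour_outside:
  assumes con: "connected_sg n S" and no: "\<not> graph_is_cycle n S c"
  obtains r v where "r < g" "v \<notin> set c" "adj n S v (c ! r)"
proof -
  have edge: "adj n S u v \<longleftrightarrow> cycle_edge c u v" if uv: "u \<in> set c" "v \<in> set c" for u v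
  proof
    assume "cycle_edge c u v"
    then show "adj n S u v"
      using cyc adj_sym[of u v] unfolding cycle_edge_def is_cycle_def by auto
  next
    assume a: "adj n S u v"
    have *: "cycle_edge c (c ! i) (c ! j) \<and> cycle_edge c (c ! j) (c ! i)"
      if ij: "i < j" "j < g" "S (c ! i) (c ! j) \<noteq> 0" for i j
      using chordless[OF that]
    proof
      assume "j = Suc i"
      then show ?thesis using ij unfolding cycle_edge_def by (auto intro!: exI[of _ i])
    next
      assume "i = 0 \<and> j = g - 1"
      moreover from this have "(j + 1) mod g = 0" using c_nonempty by simp
      ultimately show ?thesis using ij unfolding cycle_edge_def by (auto intro!: exI[of _ j])
    qed
    obtain i j where "i < g" "j < g" "u = c ! i" "v = c ! j" using uv by (auto simp: in_set_conv_nth)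
    then show "cycle_edge c u v"
      using *[of i j] *[of j i] a S_sym[of u v] S_diag[of u]
      by (cases i j rule: linorder_cases) (auto simp: adj_def)
  qed
  have sub: "set c \<subseteq> {..<n}" using c_less by (auto simp: in_set_conv_nth)
  have "set c \<noteq> {..<n}"
  proof
    assume eq: "set c = {..<n}"
    have "adj n S u v \<longleftrightarrow> cycle_edge c u v" for u v
    proof (cases "u \<in> set c \<and> v \<in> set c")
      case True
      then show ?thesis using edge by simp
    next
      case False
      then have "\<not> adj n S u v" by (auto simp: adj_def eq)
      moreover have "\<not> cycle_edge c u v"
      proof
        assume "cycle_edge c u v"
        then obtain i where i: "i < g" and "u = c ! i \<and> v = c ! ((i + 1) mod g) \<or> v = c ! i \<and> u = c ! ((i + 1) mod g)"
          unfolding cycle_edge_def by blast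
        moreover have "(i + 1) mod g < g" using i by (intro mod_less_divisor) auto
        ultimately have "u \<in> set c \<and> v \<in> set c" using nth_mem by blast
        with False show False ..
      qed
      ultimately show ?thesis by simp
    qed
    with no eq show False by (auto simp: graph_is_cycle_def)
  qed
  then obtain x where x: "x < n" "x \<notin> set c" using sub by auto
  have "(adj n S)\<^sup>*\<^sup>* (c ! 0) x" using con x c_less[of 0] c_nonempty by (auto simp: connected_sg_def)
  then have "x \<in> set c \<or> (\<exists>u v. u \<in> set c \<and> v \<notin> set c \<and> adj n S u v)"
  proof (induction rule: rtranclp_induct)
    case base
    have "0 < g" using g3 by linarith
    then show ?case by simp
  next
    case (step y z)
    then show ?case by blast
  qed
  then obtain u v where "u \<in> set c" "v \<notin> set c" "adj n S u v" using x by blast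
  then show thesis using that adj_sym[of u v] by (auto simp: in_set_conv_nth)
qed

end

section \<open>Graphs that consist of a single cycle\<close>

context shortest_cycle
begin

context
  assumes gic: "graph_is_cycle n S c"
begin

lemma app_reindex: "app z r = (\<Sum>j<g. real_of_int (S r (c ! j)) * z (c ! j))"
proof -
  have "bij_betw ((!) c) {..<g} {..<n}"
    using bij_betw_nth[OF c_distinct refl] gic by (simp add: graph_is_cycle_def)
  from sum.reindex_bij_betw[OF this, of "\<lambda>j. real_of_int (S r j) * z j"] show ?thesis
    by (simp add: app_def)
qed

lemma bil_reindex: "bil z z = (\<Sum>i<g. z (c ! i) * app z (c ! i))"
proof -
  have "bij_betw ((!) c) {..<g} {..<n}"
    using bij_betw_nth[OF c_distinct refl] gic by (simp add: graph_is_cycle_def)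
  from sum.reindex_bij_betw[OF this, of "\<lambda>i. z i * app z i"] show ?thesis
    by (simp add: bil_def)
qed

lemma app_two_neighbours:
  assumes "a < g" "b < g" "a \<noteq> b" "\<And>j. j < g \<Longrightarrow> S (c ! i) (c ! j) \<noteq> 0 \<Longrightarrow> j = a \<or> j = b"
  shows "app z (c ! i) = real_of_int (S (c ! i) (c ! a)) * z (c ! a) + real_of_int (S (c ! i) (c ! b)) * z (c ! b)"
proof -
  have "app z (c ! i) = (\<Sum>j\<in>{a, b}. real_of_int (S (c ! i) (c ! j)) * z (c ! j))"
    unfolding app_reindex using assms by (intro sum.mono_neutral_right) auto
  then show ?thesis using assms by simp
qed

lemma neighbours:
  assumes "i < g" "j < g" "S (c ! i) (c ! j) \<noteq> 0"
  shows "j = Suc i \<or> i = Suc j \<or> i = 0 \<and> j = g - 1 \<or> j = 0 \<and> i = g - 1"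
proof -
  have "i \<noteq> j" using assms S_diag by auto
  then consider "i < j" | "j < i" by linarith
  then show ?thesis
    using chordless[of i j] chordless[of j i] assms S_sym[of "c ! i" "c ! j"] by cases auto
qed

definition s :: "nat \<Rightarrow> real" where "s i = real_of_int (S (c ! i) (c ! Suc i))"
definition e :: real where "e = real_of_int (S (c ! (g - 1)) (c ! 0))"

lemma s_square: "Suc i < g \<Longrightarrow> s i * s i = 1"
  unfolding s_def using c_step[of i] S_square[of "c ! i" "c ! Suc i"]
  by (simp add: adj_def flip: of_int_mult)

lemma e_square: "e * e = 1"
  unfolding e_def using c_close S_square[of "c ! (g - 1)" "c ! 0"]
  by (simp add: adj_def flip: of_int_mult)

lemma app_inner:
  assumes "0 < i" "i < g - 1"
  shows "app z (c ! i) = s (i - 1) * z (c ! (i - 1)) + s i * z (c ! Suc i)"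
proof -
  have "app z (c ! i) = real_of_int (S (c ! i) (c ! (i - 1))) * z (c ! (i - 1))
      + real_of_int (S (c ! i) (c ! Suc i)) * z (c ! Suc i)"
    by (rule app_two_neighbours) (use assms neighbours[of i] in force)+
  then show ?thesis using assms S_sym[of "c ! i" "c ! (i - 1)"] by (simp add: s_def)
qed

lemma app_first: "app z (c ! 0) = s 0 * z (c ! 1) + e * z (c ! (g - 1))"
proof -
  have "app z (c ! 0) = real_of_int (S (c ! 0) (c ! 1)) * z (c ! 1)
      + real_of_int (S (c ! 0) (c ! (g - 1))) * z (c ! (g - 1))"
    by (rule app_two_neighbours) (use g3 neighbours[of 0] in force)+
  then show ?thesis using S_sym[of "c ! 0" "c ! (g - 1)"] by (simp add: s_def e_def)
qed

lemma app_last: "app z (c ! (g - 1)) = s (g - 2) * z (c ! (g - 2)) + e * z (c ! 0)"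
proof -
  have g2: "Suc (g - 2) = g - 1" using g3 by simp
  have "app z (c ! (g - 1)) = real_of_int (S (c ! (g - 1)) (c ! (g - 2))) * z (c ! (g - 2))
      + real_of_int (S (c ! (g - 1)) (c ! 0)) * z (c ! 0)"
    by (rule app_two_neighbours) (use g3 neighbours[of "g - 1"] in force)+
  then show ?thesis using S_sym[of "c ! (g - 1)" "c ! (g - 2)"] g2 by (simp add: s_def e_def)
qed

lemma bil_cycle:
  "bil z z = 2 * ((\<Sum>i<g - 1. s i * z (c ! i) * z (c ! Suc i)) + e * z (c ! (g - 1)) * z (c ! 0))"
proof -
  obtain h where h: "g = Suc h" "2 \<le> h" using g3 by (cases g) auto
  define f where "f i = s i * z (c ! i) * z (c ! Suc i)" for i
  define E where "E = e * z (c ! h) * z (c ! 0)"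
  \<comment> \<open>Every vertex contributes its forward and its backward edge. The closing edge
    \<open>E\<close> is forward at position \<open>h\<close> and backward at position 0, so each
    edge is counted twice.\<close>
  have "z (c ! i) * app z (c ! i) = (if i = h then E else f i) + (if i = 0 then E else f (i - 1))"
    if i: "i < Suc h" for i
  proof -
    consider "i = 0" | "i = h" | "0 < i" "i < h" using i by linarith
    then show ?thesis
    proof cases
      case 1
      then show ?thesis using h app_first[of z] by (simp add: f_def E_def algebra_simps)
    next
      case 2
      moreover have "Suc (h - 1) = h" "g - 2 = h - 1" using h by auto
      ultimately show ?thesis using h app_last[of z] by (simp add: f_def E_def algebra_simps)
    next
      case 3
      then show ?thesis using h app_inner[of i z] by (simp add: f_def algebra_simps)
    qed
  qed
  then have "bil z z = (\<Sum>i<Suc h. (if i = h then E else f i)) + (\<Sum>i<Suc h. (if i = 0 then E else f (i - 1)))"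
    unfolding bil_reindex h by (simp add: sum.distrib)
  also have "(\<Sum>i<Suc h. (if i = h then E else f i)) = (\<Sum>i<h. f i) + E" by simp
  also have "(\<Sum>i<Suc h. (if i = 0 then E else f (i - 1))) = E + (\<Sum>i<h. f i)"
    by (subst sum.lessThan_Suc_shift) simp
  finally show ?thesis using h by (simp add: f_def E_def)
qed

lemma cycle_sign_prod: "real_of_int (cycle_sign S c) = (\<Prod>i<g - 1. s i) * e"
proof -
  obtain h where h: "g = Suc h" using g3 by (cases g) auto
  have "(\<Prod>i<h. S (c ! i) (c ! (Suc i mod Suc h))) = (\<Prod>i<h. S (c ! i) (c ! Suc i))"
    by (intro prod.cong) auto
  then show ?thesis by (simp add: cycle_sign_def h s_def e_def)
qed

abbreviation m :: nat where "m \<equiv> (g - 1) div 2"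
text \<open>The sign picked up by an orthogonal vector once around the cycle: each of the
  \<open>m\<close> steps of length two contributes -1 and two edge signs, and the leftover edges
  contribute their own signs.\<close>

abbreviation \<kappa> :: real where "\<kappa> \<equiv> (-1) ^ m * real_of_int (cycle_sign S c)"

text \<open>Orthogonality to the vertex at 2j + 1 is a recurrence from position 2j to 2j + 2, so the
  value at 0 determines those at even positions up to 2m. The same relation cancels the two edges at
  2j + 1 in the form, whatever the value there.\<close>

lemma orthogonal_values:
  assumes "\<And>j. j < m \<Longrightarrow> app z (c ! (2 * j + 1)) = 0" and "k \<le> m"
  shows "z (c ! (2 * k)) = (-1) ^ k * (\<Prod>i<2 * k. s i) * z (c ! 0)"
    and "(\<Sum>i<2 * k. s i * z (c ! i) * z (c ! Suc i)) = 0"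
proof -
  have rel: "s (2 * j) * z (c ! (2 * j)) + s (2 * j + 1) * z (c ! (2 * j + 2)) = 0" if "j < m" for j
    using assms(1)[OF that] app_inner[of "2 * j + 1" z] that by simp
  show "z (c ! (2 * k)) = (-1) ^ k * (\<Prod>i<2 * k. s i) * z (c ! 0)"
    using assms(2)
  proof (induction k)
    case (Suc k)
    have "z (c ! (2 * k + 2)) = s (2 * k + 1) * s (2 * k + 1) * z (c ! (2 * k + 2))"
      using s_square[of "2 * k + 1"] Suc.prems by simp
    also have "\<dots> = - (s (2 * k + 1) * (s (2 * k) * z (c ! (2 * k))))"
      using rel[of k] Suc.prems by (simp add: mult.assoc eq_neg_iff_add_eq_0 flip: distrib_left)
    finally show ?case using Suc by simp
  qed simp
  show "(\<Sum>i<2 * k. s i * z (c ! i) * z (c ! Suc i)) = 0"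
    using assms(2)
  proof (induction k)
    case (Suc k)
    have "(\<Sum>i<2 * Suc k. s i * z (c ! i) * z (c ! Suc i)) =
        z (c ! (2 * k + 1)) * (s (2 * k) * z (c ! (2 * k)) + s (2 * k + 1) * z (c ! (2 * k + 2)))"
      using Suc by (simp add: algebra_simps)
    then show ?case using rel[of k] Suc.prems by simp
  qed simp
qed

text \<open>Only edges that are not cancelled in pairs remain: the closing edge if g is odd, and the
  two edges at position g - 1 if g is even.\<close>

lemma bil_orthogonal:
  assumes z: "\<And>j. j < m \<Longrightarrow> app z (c ! (2 * j + 1)) = 0"
  shows "bil z z = (if odd g then 2 * \<kappa> * (z (c ! 0))\<^sup>2
    else 2 * z (c ! (g - 1)) * z (c ! 0) * e * (\<kappa> + 1))"
proof (cases "odd g")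
  case True
  then obtain k where h: "g - 1 = 2 * k" by (auto elim: oddE)
  then have k: "k = m" by simp
  have "bil z z = 2 * (e * z (c ! (2 * k)) * z (c ! 0))"
    using bil_cycle[of z] orthogonal_values(2)[OF z, of k] k unfolding h by simp
  also have "z (c ! (2 * k)) = (-1) ^ k * (\<Prod>i<2 * k. s i) * z (c ! 0)"
    using orthogonal_values(1)[OF z, of k] k by simp
  finally show ?thesis
    using True cycle_sign_prod unfolding h by (simp add: power2_eq_square mult_ac)
next
  case False
  then obtain k where h: "g - 1 = Suc (2 * k)" using c_nonempty by (cases g) (auto elim: oddE)
  then have k: "k = m" by simp
  have "bil z z = 2 * (s (2 * k) * z (c ! (2 * k)) * z (c ! (g - 1)) + e * z (c ! (g - 1)) * z (c ! 0))"
    using bil_cycle[of z] orthogonal_values(2)[OF z, of k] k unfolding h by simp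
  also have "z (c ! (2 * k)) = (-1) ^ k * (\<Prod>i<2 * k. s i) * z (c ! 0)"
    using orthogonal_values(1)[OF z, of k] k by simp
  finally show ?thesis
    using False cycle_sign_prod e_square k unfolding h
    by (simp add: algebra_simps flip: mult.assoc[of e e])
qed

lemma \<kappa>_cases: "\<kappa> = 1 \<or> \<kappa> = -1"
proof -
  have "\<kappa>\<^sup>2 = ((\<Prod>i<g - 1. s i * s i) * (e * e))"
    unfolding cycle_sign_prod by (simp add: power2_eq_square prod.distrib mult_ac)
  also have "\<dots> = 1" using s_square e_square by simp
  finally show ?thesis by (simp add: power2_eq_1_iff)
qed

lemma neg_inertia_cycle: "neg = m \<longleftrightarrow> \<kappa> = (if odd g then 1 else -1)"
proof -
  interpret iso: isotropic_triangular n "\<lambda>i j. real_of_int (S i j)" "\<lambda>j. c ! (2 * j + 1)" "\<lambda>j. c ! (2 * j + 2)" m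
    by (rule isotropic_cycle)
  show ?thesis
  proof
    assume "\<kappa> = (if odd g then 1 else -1)"
    then have "neg \<le> m"
      by (intro iso.neg_inertia_le_triangular) (auto simp: bil_orthogonal)
    then show "neg = m" using neg_inertia_lower by simp
  next
    assume eq: "neg = m"
    show "\<kappa> = (if odd g then 1 else -1)"
    proof (rule ccontr)
      assume bad: "\<kappa> \<noteq> (if odd g then 1 else -1)"
      \<comment> \<open>The recurrence started with 1 at position 0. For even g the last position is
        free, and \<open>- e\<close> there makes the remaining product negative; for odd g position
        g - 1 is even and falls under the first branch.\<close>
      define Y where "Y i = (if even i then (-1) ^ (i div 2) * (\<Prod>k<i. s k) else if i = g - 1 then - e else 0)" for i
      define z where "z v = Y (inv_into {..<g} ((!) c) v)" for v
      have z: "z (c ! i) = Y i" if "i < g" for i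
        using that c_distinct by (simp add: z_def inv_into_f_f inj_on_nth)
      have orth: "app z (c ! (2 * j + 1)) = 0" if "j < m" for j
      proof -
        have "app z (c ! (2 * j + 1)) = s (2 * j) * Y (2 * j) + s (2 * j + 1) * Y (2 * j + 2)"
          using that app_inner[of "2 * j + 1" z] by (simp add: z)
        also have "\<dots> = (-1) ^ j * (\<Prod>k<2 * j. s k) * s (2 * j) * (1 - s (2 * j + 1) * s (2 * j + 1))"
          by (simp add: Y_def algebra_simps)
        finally show ?thesis using s_square[of "2 * j + 1"] that by simp
      qed
      have "z (c ! 0) = 1" using z[of 0] c_nonempty by (auto simp: Y_def)
      moreover have "z (c ! (g - 1)) = - e" if "even g" using that z[of "g - 1"] c_nonempty by (auto simp: Y_def)
      moreover have "\<kappa> = (if odd g then -1 else 1)" using bad \<kappa>_cases by (auto split: if_splits)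
      ultimately have "bil z z < 0"
        using bil_orthogonal[OF orth] e_square by (cases "odd g") simp_all
      then have "m < neg" by (intro iso.neg_inertia_gt_triangular[OF orth])
      with eq show False by simp
    qed
  qed
qed

lemma neg_inertia_cycle_mod_4:
  "neg = m \<longleftrightarrow> cycle_sign S c = 1 \<and> g mod 4 \<in> {0, 1} \<or> cycle_sign S c = -1 \<and> g mod 4 \<in> {2, 3}"
proof -
  have \<sigma>: "cycle_sign S c = 1 \<or> cycle_sign S c = -1"
    using \<kappa>_cases by (cases "even m") (auto simp: minus_equation_iff)
  \<comment> \<open>The parities of g and \<open>m\<close> together carry the residue of g modulo 4,
    and (-1)^m is the factor by which \<kappa> differs from the sign of the cycle.\<close>
  have "g mod 4 = 0 \<longleftrightarrow> even g \<and> odd m" "g mod 4 = 1 \<longleftrightarrow> odd g \<and> even m"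
    "g mod 4 = 2 \<longleftrightarrow> even g \<and> even m" "g mod 4 = 3 \<longleftrightarrow> odd g \<and> odd m"
    using g3 by presburger+
  then show ?thesis
    unfolding neg_inertia_cycle using \<sigma> by (cases "even m"; cases "even g") auto
qed

end

end

section \<open>The bound and the equality case\<close>

lemma ceiling_half: "1 \<le> g \<Longrightarrow> real_of_int \<lceil>real g / 2\<rceil> - 1 = real ((g - 1) div 2)"
proof -
  assume "1 \<le> g"
  then obtain k where "g = 2 * k + 1 \<or> g = 2 * k + 2"
    by (metis One_nat_def Suc_eq_plus1 add_2_eq_Suc' not0_implies_Suc not_one_le_zero odd_Suc_div_two oddE evenE even_Suc)
  then show ?thesis
  proof
    assume g: "g = 2 * k + 1"
    have "\<lceil>real g / 2\<rceil> = int k + 1" by (rule ceiling_unique) (auto simp: g)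
    then show ?thesis by (simp add: g)
  next
    assume g: "g = 2 * k + 2"
    have "\<lceil>real g / 2\<rceil> = int k + 1" by (rule ceiling_unique) (auto simp: g)
    then show ?thesis by (simp add: g)
  qed
qed

theorem theorem3p1:
  fixes n :: nat and S :: "nat \<Rightarrow> nat \<Rightarrow> int" and c :: "nat list"
  assumes "signed_graph n S"
    and "connected_sg n S"
    and "has_cycle n S"
    and "is_cycle n S c" and "length c = girth n S"
  shows "real (neg_inertia (adj_matrix n S)) \<ge> real_of_int \<lceil>real (girth n S) / 2\<rceil> - 1 \<and>
         (real (neg_inertia (adj_matrix n S)) = real_of_int \<lceil>real (girth n S) / 2\<rceil> - 1 \<longleftrightarrow>
         (graph_is_cycle n S c \<and>
            ((cycle_sign S c = 1 \<and> girth n S mod 4 \<in> {0, 1}) \<or>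
             (cycle_sign S c = -1 \<and> girth n S mod 4 \<in> {2, 3})))
         \<or> (\<exists>T. signed_graph n T \<and> switching_equiv n S T \<and> pos_complete_bipartite n T)
         \<or> (\<exists>l\<ge>3. complete_multipartite n S l \<and>
              (\<forall>t. is_cycle n S t \<and> length t = 3 \<longrightarrow> cycle_sign S t = -1)))"
proof -
  interpret shortest_cycle n S c
    using assms girth_le[of n S] by unfold_locales auto
  let ?m = "(g - 1) div 2"
  let ?multi = "(\<exists>T. signed_graph n T \<and> switching_equiv n S T \<and> pos_complete_bipartite n T)
         \<or> (\<exists>l\<ge>3. complete_multipartite n S l \<and>
              (\<forall>t. is_cycle n S t \<and> length t = 3 \<longrightarrow> cycle_sign S t = -1))"
  let ?cycle = "graph_is_cycle n S c \<and>
            ((cycle_sign S c = 1 \<and> g mod 4 \<in> {0, 1}) \<or>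
             (cycle_sign S c = -1 \<and> g mod 4 \<in> {2, 3}))"
  have multi: "neg = ?m" if ?multi
  proof -
    have "neg \<le> 1"
      using that neg_inertia_positive_bipartite neg_inertia_negative_multipartite by blast
    \<comment> \<open>Since g \<ge> 3 gives m \<ge> 1, the chain 1 \<le> m \<le> neg \<le> 1
      replaces a computation of the girth of a multipartite graph.\<close>
    then show ?thesis using neg_inertia_lower g3 by linarith
  qed
  have extremal: "?cycle \<or> ?multi" if eq: "neg = ?m"
  proof (cases "g \<le> 4")
    case True
    \<comment> \<open>Both g = 3 and g = 4 give m = 1. The extremal cycles of these lengths, the
      negative triangle and the positive 4-cycle, are themselves multipartite, so the second
      alternative covers them.\<close>
    then have "neg \<le> 1" using eq by linarith
    moreover have "adj n S (c ! 0) (c ! Suc 0)" using c_step[of 0] g3 by linarith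
    ultimately show ?thesis using neg_inertia_le_1_structure[OF assms(2)] by blast
  next
    case False
    have "graph_is_cycle n S c"
    proof (rule ccontr)
      assume "\<not> graph_is_cycle n S c"
      then obtain r v where rv: "r < g" "v \<notin> set c" "adj n S v (c ! r)"
        using exists_neighbour_outside[OF assms(2)] by blast
      interpret rot: shortest_cycle n S "rotate r c"
        using is_cycle_rotate[OF cyc] shortest by unfold_locales auto
      have "rotate r c ! 0 = c ! r" using rv(1) nth_rotate[of 0 c r] c_nonempty by auto
      then have "?m < neg" using rot.neg_inertia_pendant[of v] rv False by simp
      with eq show False by simp
    qed
    then show ?thesis using neg_inertia_cycle_mod_4 eq by blast
  qed
  have iff: "neg = ?m \<longleftrightarrow> ?cycle \<or> ?multi"
  proof
    assume "?cycle \<or> ?multi"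
    then show "neg = ?m"
    proof
      assume c: ?cycle
      show ?thesis using neg_inertia_cycle_mod_4[OF conjunct1[OF c]] conjunct2[OF c] by (rule iffD2)
    qed (rule multi)
  qed (rule extremal)
  have "real_of_int \<lceil>real (girth n S) / 2\<rceil> - 1 = real ?m"
    using ceiling_half[of g] g3 assms(5) by simp
  then show ?thesis
    using iff neg_inertia_lower unfolding neg_adj_matrix assms(5) by simp
qed

end
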